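(* Let $L$ be an $r\times s$ $\boldsymbol\rho$-latin rectangle with $r,s\le n$ and $n>\min\{r,s\}$. For $t\in\{r,s\}$ put $P_t=\{\ell\in[k] : \rho_\ell-e_\ell>n-t\}$ (so $P_{\min\{r,s\}}\subseteq P_{\max\{r,s\}}$), and write $\bar P_t=[k]\setminus P_t$. Call a sequence $\{(a_\ell,b_\ell)\}_{\ell=1}^k$ fitting if $a_\ell,b_\ell$ are nonnegative integers for all $\ell\in[k]$ and $$\sum_{\ell\in[k]}a_\ell=r(n-s)+|P_r|(n-r)-\sum_{\ell\in P_r}(\rho_\ell-e_\ell),$$ $$\sum_{\ell\in[k]}b_\ell=s(n-r)+|P_s|(n-s)-\sum_{\ell\in P_s}(\rho_\ell-e_\ell),$$ and for every $\ell\in[k]$: $$a_\ell+b_\ell\le\begin{cases}2n-r-s+e_\ell-\rho_\ell & \text{if } \ell\in P_{\min\{r,s\}},\\ n-\max\{r,s\} & \text{if } \ell\in P_{\max\{r,s\}}\setminus P_{\min\{r,s\}},\\ \rho_\ell-e_\ell & \text{if } \ell\in \bar P_{\max\{r,s\}}.\end{cases}$$ Then $L$ can be completed to an $n\times n$ $\boldsymbol\rho$-latin square if and only if there exists a fitting sequence $\{(a_\ell,b_\ell)\}_{\ell=1}^k$ for which one (equivalently, every) condition in the list (R1)–(R6) holds, and also one (equivalently, every) condition in the list (C1)–(C6) holds. For a fixed fitting sequence, the six conditions (R1)–(R6) are mutually equivalent, and the six conditions (C1)–(C6) are mutually equivalent. (R1) For all $I\subseteq[r]$: $$|I|(n-s)\le\sum_{\ell\in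 P_r}\min\{a_\ell+\rho_\ell-e_\ell-n+r,\ \mu_I(\ell)\}+\sum_{\ell\in\bar P_r}\min\{a_\ell,\ \mu_I(\ell)\}.$$ (R2) For all $K\subseteq[k]$: $$\sum_{\ell\in K\cap P_r}(\rho_\ell-e_\ell)\le\sum_{i\in[r]}\min\{n-s,\ \mu_K(i)\}-\sum_{\ell\in K}a_\ell+|K\cap P_r|(n-r).$$ (R3) For all $I\subseteq[r]$: $$|I|(n-s)\ge\sum_{\ell\in P_r}\big((a_\ell+\rho_\ell+\mu_I(\ell))\dot- n\big)+\sum_{\ell\in\bar P_r}\big(a_\ell\dot-\mu_{\bar I}(\ell)\big).$$ (R4) For all $K\subseteq[k]$: $$\sum_{\ell\in K\cap P_r}(\rho_\ell-e_\ell)\ge\sum_{i\in[r]}\big((n-s)\dot-\mu_{\bar K}(i)\big)+|K\cap P_r|(n-r)-\sum_{\ell\in K}a_\ell.$$ (R5) For all $I\subseteq[r]$ and $K\subseteq[k]$: $$|I|(n-s)\le\sum_{\ell\in K\cap P_r}(\rho_\ell-e_\ell)+\sum_{\ell\in K}a_\ell+\mu_I(\bar K)-|K\cap P_r|(n-r).$$ (R6) For all $I\subseteq[r]$ and $K\subseteq[k]$: $$\sum_{\ell\in K\cap P_r}(\rho_\ell-e_\ell)\le|I|(n-s)+|K\cap P_r|(n-r)+\mu_K(\bar I)-\sum_{\ell\in K}a_\ell.$$ (C1)–(C6) are obtained from (R1)–(R6), respectively, by interchanging $r$ and $s$, replacing $I\subseteq[r]$ by $J\subseteq[s]$ (with $\bar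 J=[s]\setminus J$ and column quantities $\mu_J(\ell)$, $\mu_K(j)$, $\mu_{\bar K}(j)$, $\mu_J(\bar K)$, $\mu_K(\bar J)$), replacing $P_r$ by $P_s$, and replacing $a_\ell$ by $b_\ell$. For example: (C1) For all $J\subseteq[s]$: $$|J|(n-r)\le\sum_{\ell\in P_s}\min\{b_\ell+\rho_\ell-e_\ell-n+s,\ \mu_J(\ell)\}+\sum_{\ell\in\bar P_s}\min\{b_\ell,\ \mu_J(\ell)\}.$$ (C3) For all $J\subseteq[s]$: $$|J|(n-r)\ge\sum_{\ell\in P_s}\big((b_\ell+\rho_\ell+\mu_J(\ell))\dot- n\big)+\sum_{\ell\in\bar P_s}\big(b_\ell\dot-\mu_{\bar J}(\ell)\big).$$
   Context: Let $n,k$ be positive integers. Let $\boldsymbol\rho=(\rho_1,\dots,\rho_k)$ be integers with $1\le\rho_\ell\le n\le k$ for all $\ell\in[k]=\{1,\dots,k\}$ and $\sum_{\ell\in[k]}\rho_\ell=n^2$. The symbols are the elements of $[k]$. A $\boldsymbol\rho$-latin square of order $n$ is an $n\times n$ array in which every cell contains a symbol of $[k]$, each symbol occurs at most once in each row and at most once in each column, and each symbol $\ell$ occurs exactly $\rho_\ell$ times. An $r\times s$ $\boldsymbol\rho$-latin rectangle is an $r\times s$ array in which every cell contains a symbol of $[k]$, each symbol occurs at most once in each row and at most once in each column, and each symbol $\ell$ occurs at most $\rho_\ell$ times. It can be completed to an $n\times n$ $\boldsymbol\rho$-latin square if there is a $\boldsymbol\rho$-latin square of order $n$ whose top-left $r\times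 s$ subarray equals it. For a rectangle $L$, its rows are $[r]$, its columns are $[s]$, and $e_\ell$ is the number of occurrences of symbol $\ell$ in $L$. For $i\in[r]$, $j\in[s]$, $\ell\in[k]$, $I\subseteq[r]$, $J\subseteq[s]$, $K\subseteq[k]$: - $\mu_K(i)$ is the number of symbols of $K$ not occurring in row $i$ of $L$; - $\mu_K(j)$ is the number of symbols of $K$ not occurring in column $j$ of $L$; - $\mu_I(\ell)$ is the number of rows in $I$ not containing $\ell$; - $\mu_J(\ell)$ is the number of columns in $J$ not containing $\ell$; - $\mu_K(I)=\sum_{i\in I}\mu_K(i)$, $\mu_I(K)=\sum_{\ell\in K}\mu_I(\ell)$, $\mu_K(J)=\sum_{j\in J}\mu_K(j)$, $\mu_J(K)=\sum_{\ell\in K}\mu_J(\ell)$. Complements are taken within the natural ground set: $\bar I=[r]\setminus I$, $\bar J=[s]\setminus J$, $\bar K=[k]\setminus K$. For reals $x,y$, $x\dot- y:=\max\{0,x-y\}$, and $x-y\dot- z$ means $(x-y)\dot- z$. *)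

theory Defs
  imports Main
begin

text \<open>Arrays are functions nat => nat => nat; rows are [r] = {1..r},
  columns [s] = {1..s}, symbols [k] = {1..k}. Only entries in [r] x [s] matter.\<close>

definition rho_latin_rect ::
  "nat \<Rightarrow> (nat \<Rightarrow> nat) \<Rightarrow> nat \<Rightarrow> nat \<Rightarrow> (nat \<Rightarrow> nat \<Rightarrow> nat) \<Rightarrow> bool" where
  "rho_latin_rect k rho r s L \<longleftrightarrow>
     (\<forall>i\<in>{1..r}. \<forall>j\<in>{1..s}. L i j \<in> {1..k}) \<and>
     (\<forall>i\<in>{1..r}. inj_on (\<lambda>j. L i j) {1..s}) \<and>
     (\<forall>j\<in>{1..s}. inj_on (\<lambda>i. L i j) {1..r}) \<and>
     (\<forall>l\<in>{1..k}. card {(i,j). i \<in> {1..r} \<and> j \<in> {1..s} \<and> L i j = l} \<le> rho l)"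

definition rho_latin_square ::
  "nat \<Rightarrow> nat \<Rightarrow> (nat \<Rightarrow> nat) \<Rightarrow> (nat \<Rightarrow> nat \<Rightarrow> nat) \<Rightarrow> bool" where
  "rho_latin_square n k rho M \<longleftrightarrow>
     (\<forall>i\<in>{1..n}. \<forall>j\<in>{1..n}. M i j \<in> {1..k}) \<and>
     (\<forall>i\<in>{1..n}. inj_on (\<lambda>j. M i j) {1..n}) \<and>
     (\<forall>j\<in>{1..n}. inj_on (\<lambda>i. M i j) {1..n}) \<and>
     (\<forall>l\<in>{1..k}. card {(i,j). i \<in> {1..n} \<and> j \<in> {1..n} \<and> M i j = l} = rho l)"

definition completable ::
  "nat \<Rightarrow> nat \<Rightarrow> (nat \<Rightarrow> nat) \<Rightarrow> nat \<Rightarrow> nat \<Rightarrow> (nat \<Rightarrow> nat \<Rightarrow> nat) \<Rightarrow> bool" where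
  "completable n k rho r s L \<longleftrightarrow>
     (\<exists>M. rho_latin_square n k rho M \<and> (\<forall>i\<in>{1..r}. \<forall>j\<in>{1..s}. M i j = L i j))"

definition occ :: "nat \<Rightarrow> nat \<Rightarrow> (nat \<Rightarrow> nat \<Rightarrow> nat) \<Rightarrow> nat \<Rightarrow> nat" where
  "occ r s L l = card {(i,j). i \<in> {1..r} \<and> j \<in> {1..s} \<and> L i j = l}"

definition mu_row_syms :: "nat \<Rightarrow> (nat \<Rightarrow> nat \<Rightarrow> nat) \<Rightarrow> nat set \<Rightarrow> nat \<Rightarrow> nat" where
  "mu_row_syms s L K i = card {l \<in> K. l \<notin> (\<lambda>j. L i j) ` {1..s}}"

definition mu_rows_sym :: "nat \<Rightarrow> (nat \<Rightarrow> nat \<Rightarrow> nat) \<Rightarrow> nat set \<Rightarrow> nat \<Rightarrow> nat" where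
  "mu_rows_sym s L I l = card {i \<in> I. l \<notin> (\<lambda>j. L i j) ` {1..s}}"

text \<open>Transpose: its rows are the columns of L, so column quantities of L are
  row quantities of the transpose.\<close>
definition transp_arr :: "(nat \<Rightarrow> nat \<Rightarrow> nat) \<Rightarrow> nat \<Rightarrow> nat \<Rightarrow> nat" where
  "transp_arr L = (\<lambda>i j. L j i)"

definition dminus :: "int \<Rightarrow> int \<Rightarrow> int" where
  "dminus x y = max 0 (x - y)"

definition Pset :: "nat \<Rightarrow> nat \<Rightarrow> (nat \<Rightarrow> nat) \<Rightarrow> nat \<Rightarrow> nat \<Rightarrow> (nat \<Rightarrow> nat \<Rightarrow> nat) \<Rightarrow> nat \<Rightarrow> nat set" where
  "Pset n k rho r s L t = {l \<in> {1..k}. int (rho l) - int (occ r s L l) > int n - int t}"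

definition fitting ::
  "nat \<Rightarrow> nat \<Rightarrow> (nat \<Rightarrow> nat) \<Rightarrow> nat \<Rightarrow> nat \<Rightarrow> (nat \<Rightarrow> nat \<Rightarrow> nat)
   \<Rightarrow> (nat \<Rightarrow> int) \<Rightarrow> (nat \<Rightarrow> int) \<Rightarrow> bool" where
  "fitting n k rho r s L a b \<longleftrightarrow>
    (let e = occ r s L; P = Pset n k rho r s L;
         d = (\<lambda>l. int (rho l) - int (e l)) in
     (\<forall>l\<in>{1..k}. a l \<ge> 0 \<and> b l \<ge> 0) \<and>
     (\<Sum>l\<in>{1..k}. a l) = int r * (int n - int s) + int (card (P r)) * (int n - int r)
                           - (\<Sum>l\<in>P r. d l) \<and>
     (\<Sum>l\<in>{1..k}. b l) = int s * (int n - int r) + int (card (P s)) * (int n - int s)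
                           - (\<Sum>l\<in>P s. d l) \<and>
     (\<forall>l\<in>{1..k}. a l + b l \<le>
        (if l \<in> P (min r s) then 2 * int n - int r - int s + int (e l) - int (rho l)
         else if l \<in> P (max r s) then int n - int (max r s)
         else d l)))"

definition R1 :: "nat \<Rightarrow> nat \<Rightarrow> (nat \<Rightarrow> nat) \<Rightarrow> nat \<Rightarrow> nat \<Rightarrow> (nat \<Rightarrow> nat \<Rightarrow> nat) \<Rightarrow> (nat \<Rightarrow> int) \<Rightarrow> bool" where
  "R1 n k rho r s L a \<longleftrightarrow>
    (let e = occ r s L; P = Pset n k rho r s L r; muI = mu_rows_sym s L in
     \<forall>I \<subseteq> {1..r}.
       int (card I) * (int n - int s) \<le>
         (\<Sum>l\<in>P. min (a l + int (rho l) - int (e l) - int n + int r) (int (muI I l)))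
       + (\<Sum>l\<in>{1..k} - P. min (a l) (int (muI I l))))"

definition R2 :: "nat \<Rightarrow> nat \<Rightarrow> (nat \<Rightarrow> nat) \<Rightarrow> nat \<Rightarrow> nat \<Rightarrow> (nat \<Rightarrow> nat \<Rightarrow> nat) \<Rightarrow> (nat \<Rightarrow> int) \<Rightarrow> bool" where
  "R2 n k rho r s L a \<longleftrightarrow>
    (let e = occ r s L; P = Pset n k rho r s L r; muK = mu_row_syms s L in
     \<forall>K \<subseteq> {1..k}.
       (\<Sum>l\<in>K \<inter> P. int (rho l) - int (e l)) \<le>
         (\<Sum>i\<in>{1..r}. min (int n - int s) (int (muK K i))) - (\<Sum>l\<in>K. a l)
         + int (card (K \<inter> P)) * (int n - int r))"

definition R3 :: "nat \<Rightarrow> nat \<Rightarrow> (nat \<Rightarrow> nat) \<Rightarrow> nat \<Rightarrow> nat \<Rightarrow> (nat \<Rightarrow> nat \<Rightarrow> nat) \<Rightarrow> (nat \<Rightarrow> int) \<Rightarrow> bool" where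
  "R3 n k rho r s L a \<longleftrightarrow>
    (let P = Pset n k rho r s L r; muI = mu_rows_sym s L in
     \<forall>I \<subseteq> {1..r}.
       int (card I) * (int n - int s) \<ge>
         (\<Sum>l\<in>P. dminus (a l + int (rho l) + int (muI I l)) (int n))
       + (\<Sum>l\<in>{1..k} - P. dminus (a l) (int (muI ({1..r} - I) l))))"

definition R4 :: "nat \<Rightarrow> nat \<Rightarrow> (nat \<Rightarrow> nat) \<Rightarrow> nat \<Rightarrow> nat \<Rightarrow> (nat \<Rightarrow> nat \<Rightarrow> nat) \<Rightarrow> (nat \<Rightarrow> int) \<Rightarrow> bool" where
  "R4 n k rho r s L a \<longleftrightarrow>
    (let e = occ r s L; P = Pset n k rho r s L r; muK = mu_row_syms s L in
     \<forall>K \<subseteq> {1..k}.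
       (\<Sum>l\<in>K \<inter> P. int (rho l) - int (e l)) \<ge>
         (\<Sum>i\<in>{1..r}. dminus (int n - int s) (int (muK ({1..k} - K) i)))
         + int (card (K \<inter> P)) * (int n - int r) - (\<Sum>l\<in>K. a l))"

definition R5 :: "nat \<Rightarrow> nat \<Rightarrow> (nat \<Rightarrow> nat) \<Rightarrow> nat \<Rightarrow> nat \<Rightarrow> (nat \<Rightarrow> nat \<Rightarrow> nat) \<Rightarrow> (nat \<Rightarrow> int) \<Rightarrow> bool" where
  "R5 n k rho r s L a \<longleftrightarrow>
    (let e = occ r s L; P = Pset n k rho r s L r; muI = mu_rows_sym s L in
     \<forall>I \<subseteq> {1..r}. \<forall>K \<subseteq> {1..k}.
       int (card I) * (int n - int s) \<le>
         (\<Sum>l\<in>K \<inter> P. int (rho l) - int (e l)) + (\<Sum>l\<in>K. a l)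
         + int (\<Sum>l\<in>{1..k} - K. muI I l) - int (card (K \<inter> P)) * (int n - int r))"

definition R6 :: "nat \<Rightarrow> nat \<Rightarrow> (nat \<Rightarrow> nat) \<Rightarrow> nat \<Rightarrow> nat \<Rightarrow> (nat \<Rightarrow> nat \<Rightarrow> nat) \<Rightarrow> (nat \<Rightarrow> int) \<Rightarrow> bool" where
  "R6 n k rho r s L a \<longleftrightarrow>
    (let e = occ r s L; P = Pset n k rho r s L r; muK = mu_row_syms s L in
     \<forall>I \<subseteq> {1..r}. \<forall>K \<subseteq> {1..k}.
       (\<Sum>l\<in>K \<inter> P. int (rho l) - int (e l)) \<le>
         int (card I) * (int n - int s) + int (card (K \<inter> P)) * (int n - int r)
         + int (\<Sum>i\<in>{1..r} - I. muK K i) - (\<Sum>l\<in>K. a l))"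

definition C1 where "C1 n k rho r s L b \<longleftrightarrow> R1 n k rho s r (transp_arr L) b"
definition C2 where "C2 n k rho r s L b \<longleftrightarrow> R2 n k rho s r (transp_arr L) b"
definition C3 where "C3 n k rho r s L b \<longleftrightarrow> R3 n k rho s r (transp_arr L) b"
definition C4 where "C4 n k rho r s L b \<longleftrightarrow> R4 n k rho s r (transp_arr L) b"
definition C5 where "C5 n k rho r s L b \<longleftrightarrow> R5 n k rho s r (transp_arr L) b"
definition C6 where "C6 n k rho r s L b \<longleftrightarrow> R6 n k rho s r (transp_arr L) b"

end

theory Submission
  imports Defs
begin

text \<open>
  In a completion, let \<open>A l\<close>, \<open>B l\<close>, \<open>D l\<close> count the copies of the symbol \<open>l\<close> in the top right, bottom left
  and bottom right block. Since the last \<open>n - r\<close> rows hold at most \<open>n - r\<close> copies of \<open>l\<close>, one has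
  \<open>A l = a l + max 0 (rho l - e l - (n - r))\<close> with \<open>a l \<ge> 0\<close>, and similarly for \<open>B\<close> and \<open>b\<close>; a fitting
  sequence records exactly the numerical constraints on \<open>A\<close> and \<open>B\<close>. Condition (R5) is Ore's criterion
  for choosing, for each of the first \<open>r\<close> rows, \<open>n - s\<close> missing symbols such that each \<open>l\<close> is chosen
  \<open>A l\<close> times, and the other conditions arise by optimising over \<open>I\<close> or \<open>K\<close> and by complementation.

  Conversely, given such choices for rows and for columns, choose sets of \<open>n - s\<close> symbols for the last
  \<open>n - r\<close> rows with multiplicities \<open>D l\<close>. Koenig's edge colouring theorem with \<open>n - s\<close> colours
  distributes all row sets over the last \<open>n - s\<close> columns. Then every column has a set of \<open>n - r\<close>
  symbols to be placed in its last \<open>n - r\<close> cells, and a second edge colouring places them.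
\<close>

section \<open>Hall, Koenig and Ore type theorems\<close>

text \<open>Halmos-Vaughan induction on \<open>card I\<close>. If some nonempty proper subfamily is
  tight, it and the remaining sets, stripped of its union, are handled separately. If none is tight,
  a single set may pick any element, since every other subfamily has one element to spare.\<close>

theorem hall:
  assumes "finite I" and "\<And>i. i \<in> I \<Longrightarrow> finite (A i)"
    and "\<And>J. J \<subseteq> I \<Longrightarrow> card J \<le> card (\<Union>i\<in>J. A i)"
  shows "\<exists>f. inj_on f I \<and> (\<forall>i\<in>I. f i \<in> A i)"
  using assms
proof (induction "card I" arbitrary: I A rule: less_induct)
  case less
  note hall_cond = less.prems(3)
  show ?case
  proof (cases "\<exists>J. J \<noteq> {} \<and> J \<subset> I \<and> card J = card (\<Union>i\<in>J. A i)")
    case True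
    then obtain J where J: "J \<noteq> {}" "J \<subset> I" "card J = card (\<Union>i\<in>J. A i)" by blast
    have finI: "finite I" by fact
    have finJ: "finite J" using J finI finite_subset by blast
    let ?U = "\<Union>i\<in>J. A i"
    have finU: "finite ?U" using J finJ less.prems(2) by auto
    have "card J < card I" using J(2) finI by (rule psubset_card_mono[rotated])
    then have "\<exists>f. inj_on f J \<and> (\<forall>i\<in>J. f i \<in> A i)"
    proof (rule less.hyps)
      show "finite (A i)" if "i \<in> J" for i using that J(2) less.prems(2) by blast
      show "card K \<le> card (\<Union>i\<in>K. A i)" if "K \<subseteq> J" for K
        using that J(2) by (intro hall_cond) blast
    qed (fact finJ)
    then obtain f where f: "inj_on f J" "\<forall>i\<in>J. f i \<in> A i" by blast
    have "card (I - J) < card I"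
      using J finI by (intro psubset_card_mono) auto
    \<comment> \<open>Hall's condition for \<open>K \<union> J\<close> leaves enough for
      \<open>K\<close>, because the tight \<open>J\<close> accounts for exactly
      \<open>card J\<close> elements, those of \<open>?U\<close>.\<close>
    moreover have "card K \<le> card (\<Union>i\<in>K. A i - ?U)" if K: "K \<subseteq> I - J" for K
    proof -
      have finK: "finite K" using K finI finite_subset by blast
      have "card K + card J = card (K \<union> J)"
        using K finK finJ by (subst card_Un_disjoint) auto
      also have "\<dots> \<le> card (\<Union>i\<in>K \<union> J. A i)"
        using K J by (intro hall_cond) auto
      also have "(\<Union>i\<in>K \<union> J. A i) = (\<Union>i\<in>K. A i - ?U) \<union> ?U" by auto
      also have "card \<dots> \<le> card (\<Union>i\<in>K. A i - ?U) + card ?U" by (rule card_Un_le)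
      finally show ?thesis using J by simp
    qed
    ultimately have "\<exists>g. inj_on g (I - J) \<and> (\<forall>i\<in>I - J. g i \<in> A i - ?U)"
      using finI less.prems(2) by (intro less.hyps) auto
    then obtain g where g: "inj_on g (I - J)" "\<forall>i\<in>I - J. g i \<in> A i - ?U" by blast
    let ?h = "\<lambda>i. if i \<in> J then f i else g i"
    have "inj_on ?h I"
    proof (rule inj_onI)
      fix x y assume xy: "x \<in> I" "y \<in> I" "?h x = ?h y"
      show "x = y"
        using xy f(2) g(2) inj_onD[OF f(1), of x y] inj_onD[OF g(1), of x y]
        by (cases "x \<in> J"; cases "y \<in> J"; simp) (metis DiffI)+
    qed
    moreover have "\<forall>i\<in>I. ?h i \<in> A i" using f g by auto
    ultimately show ?thesis by (intro exI[of _ ?h]) blast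
  next
    case False
    show ?thesis
    proof (cases "I = {}")
      case True then show ?thesis by auto
    next
      case False
      then obtain x where x: "x \<in> I" by blast
      have finI: "finite I" by fact
      have "card {x} \<le> card (\<Union>i\<in>{x}. A i)" using x by (intro hall_cond) auto
      then obtain a where a: "a \<in> A x" by fastforce
      have "card (I - {x}) < card I" using finI x by (rule card_Diff1_less)
      \<comment> \<open>A nonempty \<open>K\<close> avoiding \<open>x\<close> is a proper subfamily,
        hence not tight; the strict inequality absorbs the loss of \<open>a\<close>.\<close>
      moreover have "card K \<le> card (\<Union>i\<in>K. A i - {a})" if K: "K \<subseteq> I - {x}" for K
      proof (cases "K = {}")
        case False
        have "card K \<le> card (\<Union>i\<in>K. A i)" using K by (intro hall_cond) auto
        moreover have "card K \<noteq> card (\<Union>i\<in>K. A i)"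
          using K x False \<open>\<not> (\<exists>J. J \<noteq> {} \<and> J \<subset> I \<and> card J = card (\<Union>i\<in>J. A i))\<close> by blast
        moreover have "(\<Union>i\<in>K. A i - {a}) = (\<Union>i\<in>K. A i) - {a}" by auto
        moreover have "card ((\<Union>i\<in>K. A i) - {a}) \<ge> card (\<Union>i\<in>K. A i) - 1"
          by (simp add: card_Diff_singleton_if)
        ultimately show ?thesis by simp
      qed simp
      ultimately have "\<exists>g. inj_on g (I - {x}) \<and> (\<forall>i\<in>I - {x}. g i \<in> A i - {a})"
        using finI less.prems(2) by (intro less.hyps) auto
      then obtain g where g: "inj_on g (I - {x})" "\<forall>i\<in>I - {x}. g i \<in> A i - {a}" by blast
      have "inj_on (g(x := a)) I"
        using g by (auto simp: inj_on_def)
      moreover have "\<forall>i\<in>I. (g(x := a)) i \<in> A i" using g a by auto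
      ultimately show ?thesis by blast
    qed
  qed
qed

section \<open>Double counting and Koenig's edge colouring theorem\<close>

lemma finite_family_degree_sum:
  assumes "finite X" "finite Y"
  shows "(\<Sum>x\<in>X. card {y\<in>Y. R x y}) = (\<Sum>y\<in>Y. card {x\<in>X. R x y})"
  using sum.swap_restrict[OF assms, of "\<lambda>_ _. 1::nat" R] by simp

text \<open>Used in \<open>koenig_family\<close> to hand out the missing edge ends to the dummy
  vertices, \<open>D\<close> to each.\<close>

lemma exists_map_with_equal_fibres:
  fixes E :: "'e set"
  assumes "finite E" "card E = m * d"
  shows "\<exists>h. (\<forall>e\<in>E. h e < m) \<and> (\<forall>t<m. card {e\<in>E. h e = t} = d)"
  using assms
proof (induction m arbitrary: E)
  case 0 then show ?case by simp
next
  case (Suc m)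
  have "d \<le> card E" unfolding Suc.prems(2) by simp
  then obtain B where B: "B \<subseteq> E" "card B = d" "finite B"
    by (rule obtain_subset_with_card_n)
  have "card (E - B) = m * d" using card_Diff_subset[OF B(3,1)] B(2) Suc.prems(2) by simp
  with Suc.prems(1) have "\<exists>h. (\<forall>e\<in>E - B. h e < m) \<and> (\<forall>t<m. card {e\<in>E - B. h e = t} = d)"
    by (intro Suc.IH) simp_all
  then obtain h where h: "\<forall>e\<in>E - B. h e < m" "\<forall>t<m. card {e\<in>E - B. h e = t} = d"
    by blast
  define g where "g e = (if e \<in> B then m else h e)" for e
  have "card {e\<in>E. g e = t} = d" if "t < Suc m" for t
  proof (cases "t = m")
    case True
    have "{e\<in>E. g e = m} = B" using B(1) h(1) by (auto simp: g_def)
    then show ?thesis using True B(2) by simp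
  next
    case False
    then have "{e\<in>E. g e = t} = {e\<in>E - B. h e = t}" by (auto simp: g_def)
    then show ?thesis using h(2) False that by simp
  qed
  moreover have "g e < Suc m" if "e \<in> E" for e
    using h(1) that by (cases "e \<in> B") (simp_all add: g_def less_SucI)
  ultimately show ?case by blast
qed

text \<open>The matrix \<open>w\<close> holds the edge multiplicities of a \<open>D\<close>-regular
  bipartite multigraph, and \<open>m c\<close> is the matching of colour \<open>c\<close>. Hall's
  theorem yields one perfect matching; removing it lowers all degrees by one, so induction on
  \<open>D\<close> finishes.\<close>

theorem regular_matrix_decomposition:
  fixes w :: "'x \<Rightarrow> 'y \<Rightarrow> nat"
  assumes "finite X" "finite Y"
    and "\<And>x. x \<in> X \<Longrightarrow> (\<Sum>y\<in>Y. w x y) = D"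
    and "\<And>y. y \<in> Y \<Longrightarrow> (\<Sum>x\<in>X. w x y) = D"
  shows "\<exists>m. (\<forall>c<D. inj_on (m c) X \<and> m c ` X \<subseteq> Y) \<and>
             (\<forall>x\<in>X. \<forall>y\<in>Y. card {c. c < D \<and> m c x = y} = w x y)"
  using assms(3,4)
proof (induction D arbitrary: w)
  case 0
  then show ?case using assms(1,2) by auto
next
  case (Suc D)
  define A where "A x = {y\<in>Y. 0 < w x y}" for x
  \<comment> \<open>All edges at \<open>J\<close> end in \<open>?U\<close>, and no vertex of
    \<open>?U\<close> receives more than \<open>Suc D\<close> edges; compare the two edge
    counts.\<close>
  have hallcond: "card J \<le> card (\<Union>x\<in>J. A x)" if J: "J \<subseteq> X" for J
  proof -
    let ?U = "\<Union>x\<in>J. A x"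
    have U: "?U \<subseteq> Y" by (auto simp: A_def)
    have "card J * Suc D = (\<Sum>x\<in>J. \<Sum>y\<in>Y. w x y)" using J Suc.prems(1) by (simp add: subset_iff)
    also have "\<dots> = (\<Sum>x\<in>J. \<Sum>y\<in>?U. w x y)"
      using U assms(2) by (intro sum.cong sum.mono_neutral_right) (auto simp: A_def)
    also have "\<dots> = (\<Sum>y\<in>?U. \<Sum>x\<in>J. w x y)" by (rule sum.swap)
    also have "\<dots> \<le> (\<Sum>y\<in>?U. \<Sum>x\<in>X. w x y)"
      using J assms(1) by (intro sum_mono sum_mono2) auto
    also have "\<dots> = (\<Sum>y\<in>?U. Suc D)" using U Suc.prems(2) by (intro sum.cong) auto
    finally have "card J * Suc D \<le> card ?U * Suc D" by simp
    then show ?thesis by (metis mult_le_cancel2 zero_less_Suc)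
  qed
  have "\<exists>p. inj_on p X \<and> (\<forall>x\<in>X. p x \<in> A x)"
    using assms(1,2) hallcond by (intro hall) (auto simp: A_def)
  then obtain p where p: "inj_on p X" "\<forall>x\<in>X. p x \<in> A x" by blast
  \<comment> \<open>Counting all edges from both sides shows that the two sides have equal size. So
    \<open>p\<close> is onto, and every column sum drops by one as well.\<close>
  have "card X * Suc D = (\<Sum>x\<in>X. \<Sum>y\<in>Y. w x y)" using Suc.prems(1) by simp
  also have "\<dots> = (\<Sum>y\<in>Y. \<Sum>x\<in>X. w x y)" by (rule sum.swap)
  also have "\<dots> = card Y * Suc D" using Suc.prems(2) by simp
  finally have "card X = card Y" by (metis mult_cancel2 nat.distinct(1))
  then have pY: "p ` X = Y"
    using p assms(2) by (intro card_subset_eq) (auto simp: A_def card_image)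
  \<comment> \<open>The truncated subtraction is exact, because \<open>w\<close> is positive on the
    edges of the matching.\<close>
  define w' where "w' x y = w x y - (if p x = y then 1 else 0)" for x y
  have w: "w x y = w' x y + (if p x = y then 1 else 0)" if "x \<in> X" "y \<in> Y" for x y
    using p that by (auto simp: w'_def A_def)
  have "(\<Sum>y\<in>Y. w' x y) = D" if x: "x \<in> X" for x
  proof -
    have "Suc D = (\<Sum>y\<in>Y. w' x y + (if p x = y then 1 else 0))"
      using Suc.prems(1)[OF x] w[OF x] by simp
    then show ?thesis using x pY assms(2) by (auto simp: sum.distrib)
  qed
  moreover have "(\<Sum>x\<in>X. w' x y) = D" if y: "y \<in> Y" for y
  proof -
    obtain x where x: "x \<in> X" "p x = y" using y pY by auto
    have "Suc D = (\<Sum>x\<in>X. w' x y + (if p x = y then 1 else 0))"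
      using Suc.prems(2)[OF y] w[OF _ y] by simp
    also have "\<dots> = (\<Sum>x\<in>X. w' x y) + (\<Sum>z\<in>X. if z = x then 1 else 0)"
      unfolding sum.distrib using x p(1) by (intro arg_cong2[of _ _ _ _ "(+)"] sum.cong) (auto dest: inj_onD)
    finally show ?thesis using x assms(1) by simp
  qed
  ultimately obtain m where m: "\<forall>c<D. inj_on (m c) X \<and> m c ` X \<subseteq> Y"
    "\<forall>x\<in>X. \<forall>y\<in>Y. card {c. c < D \<and> m c x = y} = w' x y"
    using Suc.IH[of w'] by auto
  have "card {c. c < Suc D \<and> (m(D := p)) c x = y} = w x y" if "x \<in> X" "y \<in> Y" for x y
  proof -
    have "{c. c < Suc D \<and> (m(D := p)) c x = y} =
        {c. c < D \<and> m c x = y} \<union> (if p x = y then {D} else {})"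
      by (auto simp: less_Suc_eq)
    then show ?thesis using m(2) w that by auto
  qed
  moreover have "\<forall>c<Suc D. inj_on ((m(D := p)) c) X \<and> (m(D := p)) c ` X \<subseteq> Y"
    using m(1) p(1) pY by (auto simp: less_Suc_eq)
  ultimately show ?case by blast
qed

text \<open>Edge colouring of a bipartite graph with \<open>D\<close> colours: \<open>m x c\<close>
  is the other end of the edge of colour \<open>c\<close> at \<open>x\<close>. Bijectivity says that
  each colour occurs once at \<open>x\<close>, injectivity that no colour repeats at a vertex of
  \<open>Y\<close>.\<close>

theorem koenig_family:
  fixes S :: "'x \<Rightarrow> 'y set"
  assumes X: "finite X" and Y: "finite Y"
    and S: "\<And>x. x \<in> X \<Longrightarrow> S x \<subseteq> Y \<and> card (S x) = D"
    and deg: "\<And>y. y \<in> Y \<Longrightarrow> card {x\<in>X. y \<in> S x} \<le> D"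
  shows "\<exists>m. (\<forall>x\<in>X. bij_betw (m x) {..<D} (S x)) \<and> (\<forall>c<D. inj_on (\<lambda>x. m x c) X)"
proof (cases "D = 0")
  case True
  have "S x = {}" if "x \<in> X" for x
    using S[OF that] True finite_subset[OF _ Y] by (metis card_eq_0_iff)
  then show ?thesis using True by (intro exI[of _ undefined]) (simp add: bij_betw_def)
next
  case False
  \<comment> \<open>Pad with \<open>card Y - card X\<close> dummy vertices, joined to \<open>Y\<close> by multi-edges, to a \<open>D\<close>-regular multigraph.\<close>
  define deficit where "deficit y = D - card {x\<in>X. y \<in> S x}" for y
  define E where "E = (SIGMA y:Y. {..<deficit y})"
  have "{y\<in>Y. y \<in> S x} = S x" if "x \<in> X" for x using S[OF that] by auto
  then have "(\<Sum>x\<in>X. card {y\<in>Y. y \<in> S x}) = card X * D" using S by simp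
  then have sumdeg: "(\<Sum>y\<in>Y. card {x\<in>X. y \<in> S x}) = card X * D"
    using finite_family_degree_sum[OF X Y, of "\<lambda>x y. y \<in> S x"] by simp
  have "(\<Sum>y\<in>Y. deficit y) + card X * D = (\<Sum>y\<in>Y. deficit y + card {x\<in>X. y \<in> S x})"
    by (simp add: sum.distrib sumdeg)
  also have "\<dots> = card Y * D" using deg by (simp add: deficit_def)
  finally have tot: "(\<Sum>y\<in>Y. deficit y) + card X * D = card Y * D" .
  have "finite E" using Y by (simp add: E_def)
  moreover have "card E = (card Y - card X) * D"
  proof -
    have "card E = (\<Sum>y\<in>Y. deficit y)" using Y by (simp add: E_def)
    also have "\<dots> = card Y * D - card X * D" using tot by linarith
    finally show ?thesis by (simp add: diff_mult_distrib)
  qed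
  ultimately obtain h where h: "\<forall>e\<in>E. h e < card Y - card X"
    "\<forall>t<card Y - card X. card {e\<in>E. h e = t} = D"
    using exists_map_with_equal_fibres by blast
  \<comment> \<open>An original vertex \<open>Inl x\<close> keeps its simple edges. The multiplicity
    between \<open>Inr t\<close> and \<open>y\<close> is the number of missing edge ends
    \<open>(y, c)\<close> that \<open>h\<close> sends to \<open>t\<close>.\<close>
  define w where "w z y = (case z of Inl x \<Rightarrow> if y \<in> S x then 1 else 0
     | Inr t \<Rightarrow> card {c. c < deficit y \<and> h (y, c) = t})" for z y
  define Z where "Z = X <+> {..<card Y - card X}"
  have "(\<Sum>y\<in>Y. w z y) = D" if "z \<in> Z" for z
  proof (cases z)
    case (Inl x)
    then have "x \<in> X" using that by (auto simp: Z_def)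
    then have "{y\<in>Y. y \<in> S x} = S x" "card (S x) = D" using S by auto
    then show ?thesis using Y by (simp add: w_def Inl sum.If_cases Int_def)
  next
    case (Inr t)
    then have t: "t < card Y - card X" using that by (auto simp: Z_def)
    have "{e\<in>E. h e = t} = (SIGMA y:Y. {c. c < deficit y \<and> h (y, c) = t})" by (auto simp: E_def)
    then have "card {e\<in>E. h e = t} = (\<Sum>y\<in>Y. card {c. c < deficit y \<and> h (y, c) = t})"
      using Y by simp
    then show ?thesis using h t by (simp add: w_def Inr)
  qed
  moreover have "(\<Sum>z\<in>Z. w z y) = D" if y: "y \<in> Y" for y
  proof -
    have "(\<Sum>t<card Y - card X. card {c. c < deficit y \<and> h (y, c) = t})
        = card (SIGMA t:{..<card Y - card X}. {c. c < deficit y \<and> h (y, c) = t})"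
      by simp
    also have "\<dots> = card {..<deficit y}"
    proof (rule bij_betw_same_card[of snd], rule bij_betw_imageI)
      show "inj_on snd (SIGMA t:{..<card Y - card X}. {c. c < deficit y \<and> h (y, c) = t})"
        by (auto simp: inj_on_def)
      have "h (y, c) < card Y - card X" if "c < deficit y" for c
        using h(1) y that by (auto simp: E_def)
      then show "snd ` (SIGMA t:{..<card Y - card X}. {c. c < deficit y \<and> h (y, c) = t}) = {..<deficit y}"
        by force
    qed
    finally have "(\<Sum>t<card Y - card X. card {c. c < deficit y \<and> h (y, c) = t}) = deficit y" by simp
    then show ?thesis using X y deg[OF y]
      by (simp add: Z_def w_def sum.Plus sum.If_cases Int_def deficit_def)
  qed
  ultimately obtain m where m: "\<forall>c<D. inj_on (m c) Z \<and> m c ` Z \<subseteq> Y"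
    "\<forall>z\<in>Z. \<forall>y\<in>Y. card {c. c < D \<and> m c z = y} = w z y"
    using regular_matrix_decomposition[of Z Y w D] X Y by (force simp: Z_def)
  \<comment> \<open>Multiplicities at \<open>Inl x\<close> are 0 or 1: the zeros keep colours away
    from non-neighbours, the ones keep two colours from sharing a neighbour.\<close>
  have "bij_betw (\<lambda>c. m c (Inl x)) {..<D} (S x)" if x: "x \<in> X" for x
  proof -
    have xZ: "Inl x \<in> Z" using x by (auto simp: Z_def)
    have c: "card {c. c < D \<and> m c (Inl x) = y} = (if y \<in> S x then 1 else 0)" if "y \<in> Y" for y
      using m(2)[rule_format, OF xZ that] by (simp add: w_def)
    have "m c (Inl x) \<in> S x" if "c < D" for c
    proof (rule ccontr)
      assume "m c (Inl x) \<notin> S x"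
      moreover have "m c (Inl x) \<in> Y" using m(1) that xZ by blast
      ultimately have "card {c'. c' < D \<and> m c' (Inl x) = m c (Inl x)} = 0"
        using c[of "m c (Inl x)"] by simp
      then have "{c'. c' < D \<and> m c' (Inl x) = m c (Inl x)} = {}" by simp
      then show False using that by blast
    qed
    then have im: "(\<lambda>c. m c (Inl x)) ` {..<D} \<subseteq> S x" by auto
    have "inj_on (\<lambda>c. m c (Inl x)) {..<D}"
    proof (rule inj_onI)
      fix c c' assume cc: "c \<in> {..<D}" "c' \<in> {..<D}" "m c (Inl x) = m c' (Inl x)"
      have "m c (Inl x) \<in> S x" "S x \<subseteq> Y" using im S[OF x] cc(1) by blast+
      then have "card {d. d < D \<and> m d (Inl x) = m c (Inl x)} = 1"
        using c[of "m c (Inl x)"] by (simp add: subset_iff)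
      then obtain d0 where "{d. d < D \<and> m d (Inl x) = m c (Inl x)} = {d0}"
        by (rule card_1_singletonE)
      moreover have "c \<in> {d. d < D \<and> m d (Inl x) = m c (Inl x)}"
        "c' \<in> {d. d < D \<and> m d (Inl x) = m c (Inl x)}" using cc by simp_all
      ultimately show "c = c'" by (metis singletonD)
    qed
    moreover have "finite (S x)" using S[OF x] Y finite_subset by blast
    ultimately show ?thesis using im S[OF x]
      by (intro bij_betw_imageI card_subset_eq) (simp_all add: card_image)
  qed
  moreover have "inj_on (\<lambda>x. m c (Inl x)) X" if "c < D" for c
  proof (rule inj_onI)
    fix x x' assume "x \<in> X" "x' \<in> X" "m c (Inl x) = m c (Inl x')"
    then have "Inl x = (Inl x' :: 'x + nat)"
      using m(1) that by (intro inj_onD[of "m c" Z]) (simp_all add: Z_def InlI)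
    then show "x = x'" by simp
  qed
  ultimately show ?thesis by (intro exI[of _ "\<lambda>x c. m c (Inl x)"]) simp
qed

text \<open>Hall's theorem is applied to the edges of the bipartite graph \<open>N\<close>: an edge \<open>(x, y)\<close> takes
  either one of the \<open>A y\<close> slots of \<open>y\<close>, in which case it is chosen, or one of the \<open>card (N x) - q\<close>
  slots of \<open>x\<close>, in which case it is discarded. Hall's condition for the edges spanned by \<open>I\<close> and \<open>K\<close>
  is exactly the hypothesis for \<open>I\<close> and \<open>K\<close>.\<close>
theorem family_with_degrees:
  fixes N :: "'x \<Rightarrow> 'y set" and A :: "'y \<Rightarrow> nat"
  assumes X: "finite X" and Y: "finite Y"
    and N: "\<And>x. x \<in> X \<Longrightarrow> N x \<subseteq> Y"
    and total: "(\<Sum>y\<in>Y. A y) = card X * q"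
    and cond: "\<And>I K. I \<subseteq> X \<Longrightarrow> K \<subseteq> Y \<Longrightarrow>
      card I * q \<le> (\<Sum>y\<in>K. A y) + (\<Sum>y\<in>Y - K. card {x\<in>I. y \<in> N x})"
  shows "\<exists>S. (\<forall>x\<in>X. S x \<subseteq> N x \<and> card (S x) = q) \<and> (\<forall>y\<in>Y. card {x\<in>X. y \<in> S x} = A y)"
proof -
  have finN: "finite (N x)" if "x \<in> X" for x using N[OF that] Y finite_subset by blast
  have deg: "(\<Sum>y\<in>Y - K. card {x\<in>I. y \<in> N x}) = (\<Sum>x\<in>I. card (N x - K))"
    if "I \<subseteq> X" for I K
  proof -
    have "finite I" using that X finite_subset by blast
    moreover have "{y \<in> Y - K. y \<in> N x} = N x - K" if "x \<in> I" for x
      using N \<open>I \<subseteq> X\<close> that by blast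
    ultimately show ?thesis
      using finite_family_degree_sum[of I "Y - K" "\<lambda>x y. y \<in> N x"] Y by simp
  qed
  \<comment> \<open>The hypothesis for one vertex and empty \<open>K\<close>; it makes the
    subtraction \<open>card (N x) - q\<close> exact.\<close>
  have qN: "q \<le> card (N x)" if "x \<in> X" for x
    using cond[of "{x}" "{}"] deg[of "{x}" "{}"] that by simp
  define E where "E = Sigma X N"
  have finE: "finite E" using X finN by (simp add: E_def)
  define T where "T = (\<lambda>(x, y). (Inl ` ({y} \<times> {..<A y}) :: ('y \<times> nat + 'x \<times> nat) set)
      \<union> Inr ` ({x} \<times> {..<card (N x) - q}))"
  have hallcond: "card F \<le> card (\<Union>e\<in>F. T e)" if F: "F \<subseteq> E" for F
  proof -
    define I where "I = fst ` F"
    define K where "K = snd ` F"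
    have I: "I \<subseteq> X" "finite I" and K: "K \<subseteq> Y" "finite K"
      using F N X Y finite_subset[OF F finE] by (fastforce simp: I_def K_def E_def)+
    have "F \<subseteq> (SIGMA x:I. N x \<inter> K)" using F by (force simp: I_def K_def E_def)
    then have "card F \<le> card (SIGMA x:I. N x \<inter> K)"
      using I finN by (intro card_mono finite_SigmaI) auto
    also have "\<dots> = (\<Sum>x\<in>I. card (N x \<inter> K))" using I finN by (subst card_SigmaI) auto
    finally have 1: "card F \<le> (\<Sum>x\<in>I. card (N x \<inter> K))" .
    have "card (N x \<inter> K) + card (N x - K) = card (N x)" if "x \<in> I" for x
      using finN I that by (metis card_Int_Diff subsetD)
    then have "(\<Sum>x\<in>I. card (N x \<inter> K)) + (\<Sum>x\<in>I. card (N x - K)) = (\<Sum>x\<in>I. card (N x))"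
      by (simp flip: sum.distrib)
    moreover have "card I * q \<le> (\<Sum>y\<in>K. A y) + (\<Sum>x\<in>I. card (N x - K))"
      using cond[of I K] I K deg by simp
    moreover have "(\<Sum>x\<in>I. card (N x) - q) + card I * q = (\<Sum>x\<in>I. (card (N x) - q) + q)"
      by (simp add: sum.distrib)
    moreover have "\<dots> = (\<Sum>x\<in>I. card (N x))" using qN I by (intro sum.cong) auto
    ultimately have 2: "card F \<le> (\<Sum>y\<in>K. A y) + (\<Sum>x\<in>I. card (N x) - q)" using 1 by linarith
    have "(\<Union>e\<in>F. T e) = Inl ` (SIGMA y:K. {..<A y}) \<union> Inr ` (SIGMA x:I. {..<card (N x) - q})"
      by (auto simp: T_def I_def K_def image_iff) (force | blast)+
    also have "card \<dots> = card (SIGMA y:K. {..<A y}) + card (SIGMA x:I. {..<card (N x) - q})"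
      using I K by (subst card_Un_disjoint) (auto simp: card_image)
    also have "\<dots> = (\<Sum>y\<in>K. A y) + (\<Sum>x\<in>I. card (N x) - q)" using I K by simp
    finally show ?thesis using 2 by simp
  qed
  have "\<exists>f. inj_on f E \<and> (\<forall>e\<in>E. f e \<in> T e)"
    using finE hallcond by (intro hall) (auto simp: T_def)
  then obtain f where f: "inj_on f E" "\<forall>e\<in>E. f e \<in> T e" by blast
  \<comment> \<open>The chosen edges are those sent to \<open>Inl\<close> slots. Injectivity of
    \<open>f\<close> leaves at most \<open>card (N x) - q\<close> discarded edges at
    \<open>x\<close> and at most \<open>A y\<close> chosen ones at \<open>y\<close>.\<close>
  define S where "S x = {y \<in> N x. isl (f (x, y))}" for x
  have Sge: "card (S x) \<ge> q" if x: "x \<in> X" for x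
  proof -
    have "card (N x - S x) \<le> card (Inr ` ({x} \<times> {..<card (N x) - q}) :: ('y \<times> nat + 'x \<times> nat) set)"
      using f x by (intro card_inj_on_le[of "\<lambda>y. f (x, y)"])
        (force simp: inj_on_def E_def S_def T_def)+
    then have "card (N x - S x) \<le> card (N x) - q" by (simp add: card_image)
    moreover have "card (N x - S x) = card (N x) - card (S x)"
      using finN[OF x] by (intro card_Diff_subset) (auto simp: S_def)
    ultimately show ?thesis using qN[OF x] by simp
  qed
  have Sle: "card {x\<in>X. y \<in> S x} \<le> A y" if y: "y \<in> Y" for y
  proof -
    have "card {x\<in>X. y \<in> S x} \<le> card (Inl ` ({y} \<times> {..<A y}) :: ('y \<times> nat + 'x \<times> nat) set)"
      using f y by (intro card_inj_on_le[of "\<lambda>x. f (x, y)"])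
        (force simp: inj_on_def E_def S_def T_def)+
    then show ?thesis by (simp add: card_image)
  qed
  have "{y \<in> Y. y \<in> S x} = S x" if "x \<in> X" for x using N[OF that] by (auto simp: S_def)
  then have sums: "(\<Sum>x\<in>X. card (S x)) = (\<Sum>y\<in>Y. card {x\<in>X. y \<in> S x})"
    using finite_family_degree_sum[OF X Y, of "\<lambda>x y. y \<in> S x"] by simp
  have lo: "card X * q \<le> (\<Sum>x\<in>X. card (S x))"
    using sum_mono[of X "\<lambda>_. q" "\<lambda>x. card (S x)"] Sge by simp
  have hi: "(\<Sum>y\<in>Y. card {x\<in>X. y \<in> S x}) \<le> card X * q"
    using sum_mono[of Y "\<lambda>y. card {x\<in>X. y \<in> S x}" A] Sle total by simp
  \<comment> \<open>The lower bounds at \<open>X\<close> and the upper bounds at \<open>Y\<close>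
    have the same total, so each of them is an equality.\<close>
  have "card (S x) = q" if "x \<in> X" for x
    using sum_mono_inv[of "\<lambda>_. q" X "\<lambda>x. card (S x)"] Sge lo hi sums X that by simp
  moreover have "card {x\<in>X. y \<in> S x} = A y" if "y \<in> Y" for y
    using sum_mono_inv[of "\<lambda>y. card {x\<in>X. y \<in> S x}" Y A] Sle lo hi sums total Y that by simp
  ultimately show ?thesis by (intro exI[of _ S]) (auto simp: S_def)
qed

text \<open>In a complete bipartite graph Ore's condition follows from the degree bounds. If
  \<open>q \<le> card (Y - K)\<close>, the complement of \<open>K\<close> suffices. Otherwise start
  from the inequality for all of \<open>X\<close>: each vertex dropped to reach \<open>I\<close>
  lowers the left side by \<open>q\<close> and the right side by only
  \<open>card (Y - K)\<close>.\<close>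

corollary family_with_degrees_complete:
  fixes A :: "'y \<Rightarrow> nat"
  assumes X: "finite X" and Y: "finite Y"
    and total: "(\<Sum>y\<in>Y. A y) = card X * q"
    and A: "\<And>y. y \<in> Y \<Longrightarrow> A y \<le> card X"
  shows "\<exists>S. (\<forall>x\<in>X. S x \<subseteq> Y \<and> card (S x) = q) \<and> (\<forall>y\<in>Y. card {x\<in>X. y \<in> S x} = A y)"
proof (rule family_with_degrees[OF X Y _ total])
  fix I K assume I: "I \<subseteq> X" and K: "K \<subseteq> Y"
  have finK: "finite K" using K Y finite_subset by blast
  have cI: "card I \<le> card X" using I X by (rule card_mono[rotated])
  have "(\<Sum>y\<in>Y - K. card {x\<in>I. y \<in> Y}) = card (Y - K) * card I" by simp
  moreover have "card I * q \<le> (\<Sum>y\<in>K. A y) + card (Y - K) * card I"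
  proof (cases "q \<le> card (Y - K)")
    case True
    then have "card I * q \<le> card I * card (Y - K)" by (rule mult_le_mono2)
    then show ?thesis by (metis mult.commute trans_le_add2)
  next
    case False
    have "(\<Sum>y\<in>Y - K. A y) \<le> (\<Sum>y\<in>Y - K. card X)" using A by (intro sum_mono) auto
    then have "(\<Sum>y\<in>Y - K. A y) \<le> card (Y - K) * card X" by simp
    moreover have "(\<Sum>y\<in>Y. A y) = (\<Sum>y\<in>K. A y) + (\<Sum>y\<in>Y - K. A y)"
      using K Y by (simp add: sum.subset_diff)
    ultimately have 1: "card X * q \<le> (\<Sum>y\<in>K. A y) + card (Y - K) * card X" using total by simp
    obtain u where u: "card X = card I + u" using cI le_Suc_ex by blast
    have "u * card (Y - K) \<le> u * q" using False by (intro mult_le_mono2) simp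
    moreover have "card I * q + u * q \<le> (\<Sum>y\<in>K. A y) + card (Y - K) * card I + u * card (Y - K)"
      using 1 unfolding u by (simp add: algebra_simps)
    ultimately show ?thesis by linarith
  qed
  ultimately show "card I * q \<le> (\<Sum>y\<in>K. A y) + (\<Sum>y\<in>Y - K. card {x\<in>I. y \<in> Y})" by simp
qed auto

section \<open>Equivalent forms of the degree condition\<close>

text \<open>The sum of minima is the least right-hand side over all \<open>K\<close>, attained at
  the \<open>K\<close> where \<open>f\<close> is at most \<open>g\<close>. This trades a quantified
  set for a minimum.\<close>

lemma le_sum_min_iff:
  fixes f g :: "'a \<Rightarrow> int"
  assumes "finite Y"
  shows "c \<le> (\<Sum>y\<in>Y. min (f y) (g y)) \<longleftrightarrow>
    (\<forall>K. K \<subseteq> Y \<longrightarrow> c \<le> (\<Sum>y\<in>K. f y) + (\<Sum>y\<in>Y - K. g y))"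
proof
  assume c: "c \<le> (\<Sum>y\<in>Y. min (f y) (g y))"
  show "\<forall>K. K \<subseteq> Y \<longrightarrow> c \<le> (\<Sum>y\<in>K. f y) + (\<Sum>y\<in>Y - K. g y)"
  proof (intro allI impI)
    fix K assume K: "K \<subseteq> Y"
    have "(\<Sum>y\<in>Y. min (f y) (g y)) = (\<Sum>y\<in>Y - K. min (f y) (g y)) + (\<Sum>y\<in>K. min (f y) (g y))"
      using K assms by (rule sum.subset_diff)
    also have "\<dots> \<le> (\<Sum>y\<in>Y - K. g y) + (\<Sum>y\<in>K. f y)"
      by (intro add_mono sum_mono) auto
    finally show "c \<le> (\<Sum>y\<in>K. f y) + (\<Sum>y\<in>Y - K. g y)" using c by simp
  qed
next
  assume *: "\<forall>K. K \<subseteq> Y \<longrightarrow> c \<le> (\<Sum>y\<in>K. f y) + (\<Sum>y\<in>Y - K. g y)"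
  let ?K = "{y\<in>Y. f y \<le> g y}"
  have "(\<Sum>y\<in>Y. min (f y) (g y)) =
      (\<Sum>y\<in>Y - ?K. min (f y) (g y)) + (\<Sum>y\<in>?K. min (f y) (g y))"
    by (rule sum.subset_diff) (use assms in auto)
  also have "\<dots> = (\<Sum>y\<in>Y - ?K. g y) + (\<Sum>y\<in>?K. f y)"
    by (intro arg_cong2[of _ _ _ _ "(+)"] sum.cong) auto
  finally show "c \<le> (\<Sum>y\<in>Y. min (f y) (g y))" using *[rule_format, of ?K] by simp
qed

lemma all_subsets_complement_iff:
  "(\<forall>I. I \<subseteq> X \<longrightarrow> Q (X - I)) \<longleftrightarrow> (\<forall>I. I \<subseteq> X \<longrightarrow> Q I)"
  by (metis Diff_subset double_diff subset_refl)

lemma sum_dminus: "(\<Sum>y\<in>Y. dminus (f y) (g y)) = (\<Sum>y\<in>Y. f y) - (\<Sum>y\<in>Y. min (f y) (g y))"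
  by (simp add: dminus_def flip: sum_subtractf) (intro sum.cong; auto simp: min_def max_def)

text \<open>With \<open>R\<close> read as "missing from the row", \<open>T1\<close> and
  \<open>?T2\<close> to \<open>?T6\<close> become \<open>R1\<close> to \<open>R6\<close>.
  \<open>?T5\<close> is \<open>T1\<close> with the minimum over symbols resolved. Complementing both
  sets and using \<open>total\<close> turns \<open>?T6\<close> into \<open>?T5\<close>, and
  \<open>?T2\<close> is \<open>?T6\<close> with the minimum over rows restored. \<open>?T3\<close>
  and \<open>?T4\<close> are complemented forms of \<open>T1\<close> and \<open>?T2\<close>.\<close>

lemma degree_conditions_equiv:
  fixes R :: "'x \<Rightarrow> 'y \<Rightarrow> bool" and A :: "'y \<Rightarrow> int" and q :: int
  assumes X: "finite X" and Y: "finite Y" and total: "(\<Sum>y\<in>Y. A y) = int (card X) * q"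
  defines "T1 \<equiv> \<forall>I. I \<subseteq> X \<longrightarrow> int (card I) * q \<le> (\<Sum>y\<in>Y. min (A y) (int (card {x\<in>I. R x y})))"
  shows "(\<forall>I. I \<subseteq> X \<longrightarrow> (\<forall>K. K \<subseteq> Y \<longrightarrow> int (card I) * q
            \<le> (\<Sum>y\<in>K. A y) + int (\<Sum>y\<in>Y - K. card {x\<in>I. R x y}))) \<longleftrightarrow> T1" (is "?T5 \<longleftrightarrow> _")
    and "(\<forall>I. I \<subseteq> X \<longrightarrow> (\<forall>K. K \<subseteq> Y \<longrightarrow> (\<Sum>y\<in>K. A y)
            \<le> int (card I) * q + int (\<Sum>x\<in>X - I. card {y\<in>K. R x y}))) \<longleftrightarrow> T1" (is "?T6 \<longleftrightarrow> _")
    and "(\<forall>K. K \<subseteq> Y \<longrightarrow> (\<Sum>y\<in>K. A y) \<le> (\<Sum>x\<in>X. min q (int (card {y\<in>K. R x y})))) \<longleftrightarrow> T1"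
        (is "?T2 \<longleftrightarrow> _")
    and "(\<forall>I. I \<subseteq> X \<longrightarrow> (\<Sum>y\<in>Y. dminus (A y) (int (card {x\<in>X - I. R x y})))
            \<le> int (card I) * q) \<longleftrightarrow> T1" (is "?T3 \<longleftrightarrow> _")
    and "(\<forall>K. K \<subseteq> Y \<longrightarrow> (\<Sum>x\<in>X. dminus q (int (card {y\<in>Y - K. R x y})))
            \<le> (\<Sum>y\<in>K. A y)) \<longleftrightarrow> T1" (is "?T4 \<longleftrightarrow> _")
proof -
  have cardX: "int (card (X - I)) * q = int (card X) * q - int (card I) * q" if "I \<subseteq> X" for I
    using that X finite_subset[OF that X]
    by (simp add: card_Diff_subset of_nat_diff card_mono left_diff_distrib)
  have sumY: "(\<Sum>y\<in>Y - K. A y) = int (card X) * q - (\<Sum>y\<in>K. A y)" if "K \<subseteq> Y" for K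
    using total sum.subset_diff[OF that Y, of A] by simp
  have deg: "(\<Sum>y\<in>K. card {x\<in>I. R x y}) = (\<Sum>x\<in>I. card {y\<in>K. R x y})"
    if "I \<subseteq> X" "K \<subseteq> Y" for I K
    using finite_family_degree_sum[of I K R] finite_subset[OF that(1) X] finite_subset[OF that(2) Y]
    by simp
  show T5: "?T5 \<longleftrightarrow> T1" unfolding T1_def using le_sum_min_iff[OF Y] by simp
  have "?T6 \<longleftrightarrow> (\<forall>I. I \<subseteq> X \<longrightarrow> (\<forall>K. K \<subseteq> Y \<longrightarrow> (\<Sum>y\<in>Y - K. A y)
            \<le> int (card (X - I)) * q + int (\<Sum>x\<in>X - (X - I). card {y\<in>Y - K. R x y})))"
    unfolding all_subsets_complement_iff[of Y "\<lambda>K. (\<Sum>y\<in>K. A y)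
            \<le> int (card (X - _)) * q + int (\<Sum>x\<in>X - (X - _). card {y\<in>K. R x y})"]
    unfolding all_subsets_complement_iff[of X "\<lambda>I. \<forall>K. K \<subseteq> Y \<longrightarrow> (\<Sum>y\<in>K. A y)
            \<le> int (card I) * q + int (\<Sum>x\<in>X - I. card {y\<in>K. R x y})"] ..
  also have "\<dots> \<longleftrightarrow> ?T5"
    by (intro all_cong1 imp_cong refl) (auto simp: cardX sumY deg double_diff)
  finally show T6: "?T6 \<longleftrightarrow> T1" using T5 by simp
  have "?T2 \<longleftrightarrow> (\<forall>K. K \<subseteq> Y \<longrightarrow> (\<forall>I. I \<subseteq> X \<longrightarrow> (\<Sum>y\<in>K. A y)
            \<le> int (card I) * q + int (\<Sum>x\<in>X - I. card {y\<in>K. R x y})))"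
    unfolding le_sum_min_iff[OF X] by simp
  then show T2: "?T2 \<longleftrightarrow> T1" using T6 by blast
  have "?T3 \<longleftrightarrow> (\<forall>I. I \<subseteq> X \<longrightarrow>
      int (card (X - I)) * q \<le> (\<Sum>y\<in>Y. min (A y) (int (card {x\<in>X - I. R x y}))))"
    by (intro all_cong1 imp_cong refl) (auto simp: cardX sum_dminus total)
  then show "?T3 \<longleftrightarrow> T1" unfolding T1_def
    using all_subsets_complement_iff[of X "\<lambda>I. int (card I) * q \<le> (\<Sum>y\<in>Y. min (A y) (int (card {x\<in>I. R x y})))"]
    by simp
  have "?T4 \<longleftrightarrow> (\<forall>K. K \<subseteq> Y \<longrightarrow>
      (\<Sum>y\<in>Y - K. A y) \<le> (\<Sum>x\<in>X. min q (int (card {y\<in>Y - K. R x y}))))"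
    by (intro all_cong1 imp_cong refl) (auto simp: sumY sum_dminus)
  also have "\<dots> \<longleftrightarrow> ?T2"
    by (rule all_subsets_complement_iff[of Y "\<lambda>K. (\<Sum>y\<in>K. A y) \<le> (\<Sum>x\<in>X. min q (int (card {y\<in>K. R x y})))"])
  finally show "?T4 \<longleftrightarrow> T1" using T2 by simp
qed

section \<open>Completing a rectangle from degree-constrained families\<close>

text \<open>Counts in arbitrary blocks allow the array to be cut into four parts that are counted
  separately.\<close>

definition occ_in :: "nat set \<Rightarrow> nat set \<Rightarrow> (nat \<Rightarrow> nat \<Rightarrow> nat) \<Rightarrow> nat \<Rightarrow> nat" where
  "occ_in I J M l = card {(i,j). i \<in> I \<and> j \<in> J \<and> M i j = l}"

lemma occ_eq_occ_in: "occ r s L l = occ_in {1..r} {1..s} L l"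
  by (simp add: occ_def occ_in_def)

lemma occ_in_transp: "occ_in J I (transp_arr M) l = occ_in I J M l"
  unfolding occ_in_def
  by (rule bij_betw_same_card[of "\<lambda>(j, i). (i, j)"])
    (auto simp: transp_arr_def bij_betw_def inj_on_def image_iff)

lemma occ_in_cong:
  assumes "\<And>i j. i \<in> I \<Longrightarrow> j \<in> J \<Longrightarrow> M i j = M' i j"
  shows "occ_in I J M l = occ_in I J M' l"
  unfolding occ_in_def using assms by (intro arg_cong[of _ _ card]) auto

lemma occ_in_Un_rows:
  assumes "finite I" "finite I'" "finite J" "I \<inter> I' = {}"
  shows "occ_in (I \<union> I') J M l = occ_in I J M l + occ_in I' J M l"
proof -
  have "{(i,j). i \<in> I \<union> I' \<and> j \<in> J \<and> M i j = l} =
      {(i,j). i \<in> I \<and> j \<in> J \<and> M i j = l} \<union> {(i,j). i \<in> I' \<and> j \<in> J \<and> M i j = l}"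
    by auto
  moreover have "finite {(i,j). i \<in> I \<and> j \<in> J \<and> M i j = l}"
    by (rule finite_subset[of _ "I \<times> J"]) (use assms in auto)
  moreover have "finite {(i,j). i \<in> I' \<and> j \<in> J \<and> M i j = l}"
    by (rule finite_subset[of _ "I' \<times> J"]) (use assms in auto)
  ultimately show ?thesis
    unfolding occ_in_def using assms(4) by (simp add: card_Un_disjoint disjoint_iff)
qed

lemma occ_in_Un_cols:
  assumes "finite I" "finite J" "finite J'" "J \<inter> J' = {}"
  shows "occ_in I (J \<union> J') M l = occ_in I J M l + occ_in I J' M l"
  using occ_in_Un_rows[of J J' I "transp_arr M" l] assms by (simp add: occ_in_transp)

text \<open>A row with distinct entries holds \<open>l\<close> in at most one cell, so projecting
  cells to their rows is injective.\<close>

lemma occ_in_eq_card_rows: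
  assumes "\<And>i. i \<in> I \<Longrightarrow> inj_on (M i) J"
  shows "occ_in I J M l = card {i\<in>I. l \<in> M i ` J}"
  unfolding occ_in_def
proof (rule bij_betw_same_card[of fst], rule bij_betw_imageI)
  show "inj_on fst {(i,j). i \<in> I \<and> j \<in> J \<and> M i j = l}"
    using assms by (fastforce simp: inj_on_def)
  show "fst ` {(i,j). i \<in> I \<and> j \<in> J \<and> M i j = l} = {i\<in>I. l \<in> M i ` J}"
    by force
qed

lemma occ_in_le_card_rows:
  assumes "finite I" "\<And>i. i \<in> I \<Longrightarrow> inj_on (M i) J"
  shows "occ_in I J M l \<le> card I"
proof -
  have "card {i\<in>I. l \<in> M i ` J} \<le> card I" using assms(1) by (intro card_mono) auto
  then show ?thesis using occ_in_eq_card_rows[of I M J l] assms(2) by simp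
qed

lemma sum_occ_in:
  assumes "finite I" "finite J" "\<And>i j. i \<in> I \<Longrightarrow> j \<in> J \<Longrightarrow> M i j \<in> {1..k}"
  shows "(\<Sum>l\<in>{1..k}. occ_in I J M l) = card I * card J"
proof -
  have "(\<Sum>l\<in>{1..k}. occ_in I J M l)
      = (\<Sum>l\<in>{1..k}. card {p\<in>I \<times> J. M (fst p) (snd p) = l})"
    unfolding occ_in_def by (intro sum.cong refl arg_cong[of _ _ card]) auto
  also have "\<dots> = (\<Sum>p\<in>I \<times> J. card {l\<in>{1..k}. M (fst p) (snd p) = l})"
    using assms by (intro finite_family_degree_sum[symmetric]) auto
  also have "\<dots> = (\<Sum>p\<in>I \<times> J. 1)"
  proof (intro sum.cong refl)
    fix p assume "p \<in> I \<times> J"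
    then have "{l\<in>{1..k}. M (fst p) (snd p) = l} = {M (fst p) (snd p)}"
      using assms(3)[of "fst p" "snd p"] by auto
    then show "card {l\<in>{1..k}. M (fst p) (snd p) = l} = 1" by simp
  qed
  also have "\<dots> = card I * card J" by (simp add: card_cartesian_product)
  finally show ?thesis .
qed

lemma inj_on_UnI:
  assumes "inj_on f A" "inj_on f B" "\<And>x y. x \<in> A \<Longrightarrow> y \<in> B \<Longrightarrow> f x \<noteq> f y"
  shows "inj_on f (A \<union> B)"
  unfolding inj_on_Un using assms by blast

section \<open>Construction of the completed square by two edge colourings\<close>

text \<open>\<open>F i\<close> and \<open>H j\<close> prescribe the symbols of the last cells in row
  \<open>i\<close> and column \<open>j\<close>. With \<open>D l\<close> copies left for the last
  block, \<open>Bmin\<close> reads \<open>A l + D l \<le> n - s\<close> and \<open>Amin\<close>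
  reads \<open>B l + D l \<le> n - r\<close>: the degree bounds for the first and the second
  colouring.\<close>

lemma completable_if_families:
  assumes rn: "r \<le> n" and sn: "s \<le> n" and rect: "rho_latin_rect k rho r s L"
    and rho_sum: "(\<Sum>l\<in>{1..k}. rho l) = n ^ 2"
    and F: "\<And>i. i \<in> {1..r} \<Longrightarrow> F i \<subseteq> {1..k} - L i ` {1..s} \<and> card (F i) = n - s"
    and FA: "\<And>l. l \<in> {1..k} \<Longrightarrow> card {i\<in>{1..r}. l \<in> F i} = A l"
    and H: "\<And>j. j \<in> {1..s} \<Longrightarrow> H j \<subseteq> {1..k} - (\<lambda>i. L i j) ` {1..r} \<and> card (H j) = n - r"
    and HB: "\<And>l. l \<in> {1..k} \<Longrightarrow> card {j\<in>{1..s}. l \<in> H j} = B l"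
    and AB: "\<And>l. l \<in> {1..k} \<Longrightarrow> occ r s L l + A l + B l \<le> rho l"
    and Amin: "\<And>l. l \<in> {1..k} \<Longrightarrow> rho l \<le> occ r s L l + A l + (n - r)"
    and Bmin: "\<And>l. l \<in> {1..k} \<Longrightarrow> rho l \<le> occ r s L l + B l + (n - s)"
  shows "completable n k rho r s L"
proof -
  define u where "u = n - r"
  define v where "v = n - s"
  have nru: "n = r + u" and nsv: "n = s + v" using rn sn by (simp_all add: u_def v_def)
  have L: "\<And>i j. i \<in> {1..r} \<Longrightarrow> j \<in> {1..s} \<Longrightarrow> L i j \<in> {1..k}"
    "\<And>i. i \<in> {1..r} \<Longrightarrow> inj_on (L i) {1..s}"
    "\<And>j. j \<in> {1..s} \<Longrightarrow> inj_on (\<lambda>i. L i j) {1..r}"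
    using rect by (simp_all add: rho_latin_rect_def)
  \<comment> \<open>\<open>D l\<close> is the number of copies of \<open>l\<close> in the bottom right block, \<open>G\<close> a provisional choice of its rows.
    Colouring \<open>F\<close> and \<open>G\<close> jointly fixes the last \<open>n - s\<close> columns; from \<open>G\<close> only the set of bottom
    symbols of each such column is kept, and a second colouring distributes them over the rows.\<close>
  define D where "D l = rho l - (occ r s L l + A l + B l)" for l
  have rhoD: "rho l = occ r s L l + A l + B l + D l" if "l \<in> {1..k}" for l
    using AB[OF that] by (simp add: D_def)
  have AD: "A l + D l \<le> v" and BD: "B l + D l \<le> u" if "l \<in> {1..k}" for l
    using rhoD[OF that] Amin[OF that] Bmin[OF that] by (simp_all add: u_def v_def)
  have "{l\<in>{1..k}. l \<in> F i} = F i" if "i \<in> {1..r}" for i using F[OF that] by auto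
  then have sumA: "(\<Sum>l\<in>{1..k}. A l) = r * v"
    using finite_family_degree_sum[of "{1..r}" "{1..k}" "\<lambda>i l. l \<in> F i"] FA F by (simp add: v_def)
  have "{l\<in>{1..k}. l \<in> H j} = H j" if "j \<in> {1..s}" for j using H[OF that] by auto
  then have sumB: "(\<Sum>l\<in>{1..k}. B l) = s * u"
    using finite_family_degree_sum[of "{1..s}" "{1..k}" "\<lambda>i l. l \<in> H i"] HB H by (simp add: u_def)
  have "(\<Sum>l\<in>{1..k}. occ r s L l) = r * s"
    using sum_occ_in[of "{1..r}" "{1..s}" L k] L(1) by (simp add: occ_eq_occ_in)
  \<comment> \<open>The other three blocks have \<open>r * s\<close>, \<open>r * v\<close> and
    \<open>s * u\<close> cells, which leaves \<open>u * v\<close> for the copies counted by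
    \<open>D\<close>.\<close>
  then have "n ^ 2 = r * s + r * v + s * u + (\<Sum>l\<in>{1..k}. D l)"
    using rho_sum rhoD sumA sumB by (simp add: sum.distrib)
  moreover have "n ^ 2 = (r + u) * (s + v)" using nru nsv by (metis power2_eq_square)
  ultimately have sumD: "(\<Sum>l\<in>{1..k}. D l) = card {Suc r..n} * v"
    using nru by (simp add: algebra_simps)
  have "\<exists>G. (\<forall>i\<in>{Suc r..n}. G i \<subseteq> {1..k} \<and> card (G i) = v) \<and>
      (\<forall>l\<in>{1..k}. card {i\<in>{Suc r..n}. l \<in> G i} = D l)"
    using sumD BD nru by (intro family_with_degrees_complete) (force dest: add_leD2)+
  then obtain G where G: "\<And>i. i \<in> {Suc r..n} \<Longrightarrow> G i \<subseteq> {1..k} \<and> card (G i) = v"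
    "\<And>l. l \<in> {1..k} \<Longrightarrow> card {i\<in>{Suc r..n}. l \<in> G i} = D l" by blast

  define S where "S i = (if i \<le> r then F i else G i)" for i
  have Sk: "S i \<subseteq> {1..k} \<and> card (S i) = v" if "i \<in> {1..n}" for i
    using F[of i] G(1)[of i] that by (auto simp: S_def v_def)
  have "card {i\<in>{1..n}. l \<in> S i} \<le> v" if l: "l \<in> {1..k}" for l
  proof -
    have "{i\<in>{1..n}. l \<in> S i} = {i\<in>{1..r}. l \<in> F i} \<union> {i\<in>{Suc r..n}. l \<in> G i}"
      using rn by (auto simp: S_def)
    then have "card {i\<in>{1..n}. l \<in> S i} \<le> card {i\<in>{1..r}. l \<in> F i} + card {i\<in>{Suc r..n}. l \<in> G i}"
      by (simp only: card_Un_le)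
    then show ?thesis using FA[OF l] G(2)[OF l] AD[OF l] by simp
  qed
  with Sk obtain m1 where m1: "\<forall>i\<in>{1..n}. bij_betw (m1 i) {..<v} (S i)"
    "\<forall>c<v. inj_on (\<lambda>i. m1 i c) {1..n}"
    using koenig_family[of "{1..n}" "{1..k}" S v] by auto
  \<comment> \<open>Colour \<open>c\<close> of the first colouring is column
    \<open>Suc s + c\<close>.\<close>
  define Q where "Q i j = m1 i (j - Suc s)" for i j
  have col_idx: "j - Suc s \<in> {..<v}" if "j \<in> {Suc s..n}" for j using that nsv by auto
  have Q_in: "Q i j \<in> S i" if "i \<in> {1..n}" "j \<in> {Suc s..n}" for i j
    using m1(1) that col_idx bij_betwE unfolding Q_def by blast
  have Q_row: "inj_on (Q i) {Suc s..n}" if i: "i \<in> {1..n}" for i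
  proof (rule inj_onI)
    fix j j' assume j: "j \<in> {Suc s..n}" "j' \<in> {Suc s..n}" "Q i j = Q i j'"
    have "j - Suc s = j' - Suc s"
      using bij_betw_imp_inj_on[OF m1(1)[rule_format, OF i]] j col_idx
      unfolding Q_def by (blast dest: inj_onD)
    then show "j = j'" using j by auto
  qed
  have Q_col: "inj_on (\<lambda>i. Q i j) {1..n}" if "j \<in> {Suc s..n}" for j
    using m1(2) col_idx[OF that] by (simp add: Q_def)

  define U where "U j = (if j \<le> s then H j else (\<lambda>i. Q i j) ` {Suc r..n})" for j
  have Uk: "U j \<subseteq> {1..k} \<and> card (U j) = u" if j: "j \<in> {1..n}" for j
  proof (cases "j \<le> s")
    case True
    then show ?thesis using H[of j] j by (auto simp: U_def u_def)
  next
    case False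
    then have j': "j \<in> {Suc s..n}" using j by auto
    have "inj_on (\<lambda>i. Q i j) {Suc r..n}"
      by (rule inj_on_subset[OF Q_col[OF j']]) auto
    then have "card (U j) = u" using False by (simp add: U_def card_image u_def)
    moreover have "Q i j \<in> {1..k}" if "i \<in> {Suc r..n}" for i
      using Q_in[OF _ j', of i] Sk[of i] that by auto
    ultimately show ?thesis using False by (auto simp: U_def)
  qed
  have Udeg: "card {j\<in>{1..n}. l \<in> U j} \<le> B l + D l" if l: "l \<in> {1..k}" for l
  proof -
    have "{j\<in>{1..n}. l \<in> U j} = {j\<in>{1..s}. l \<in> H j} \<union> {j\<in>{Suc s..n}. l \<in> (\<lambda>i. Q i j) ` {Suc r..n}}"
      using sn by (auto simp: U_def)
    then have 1: "card {j\<in>{1..n}. l \<in> U j} \<le> card {j\<in>{1..s}. l \<in> H j}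
        + card {j\<in>{Suc s..n}. l \<in> (\<lambda>i. Q i j) ` {Suc r..n}}"
      by (simp only: card_Un_le)
    have inj: "inj_on (transp_arr Q j) {Suc r..n}" if "j \<in> {Suc s..n}" for j
      unfolding transp_arr_def by (rule inj_on_subset[OF Q_col[OF that]]) auto
    \<comment> \<open>Copies of \<open>l\<close> in the bottom right block of \<open>Q\<close> are
      counted first by columns, then by rows, where row \<open>i\<close> only uses symbols of
      \<open>G i\<close>.\<close>
    have "card {j\<in>{Suc s..n}. l \<in> (\<lambda>i. Q i j) ` {Suc r..n}}
        = occ_in {Suc s..n} {Suc r..n} (transp_arr Q) l"
      using occ_in_eq_card_rows[of "{Suc s..n}" "transp_arr Q" "{Suc r..n}" l] inj
      by (simp add: transp_arr_def)
    also have "\<dots> = occ_in {Suc r..n} {Suc s..n} Q l" by (rule occ_in_transp)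
    also have "\<dots> = card {i\<in>{Suc r..n}. l \<in> Q i ` {Suc s..n}}"
      using Q_row by (intro occ_in_eq_card_rows) auto
    also have "\<dots> \<le> card {i\<in>{Suc r..n}. l \<in> G i}"
    proof (rule card_mono)
      have "Q i j \<in> G i" if "i \<in> {Suc r..n}" "j \<in> {Suc s..n}" for i j
        using Q_in[of i j] that by (simp add: S_def)
      then show "{i\<in>{Suc r..n}. l \<in> Q i ` {Suc s..n}} \<subseteq> {i\<in>{Suc r..n}. l \<in> G i}" by blast
    qed simp
    finally show ?thesis using 1 HB[OF l] G(2)[OF l] by simp
  qed
  have "card {j\<in>{1..n}. l \<in> U j} \<le> u" if "l \<in> {1..k}" for l
    using Udeg[OF that] BD[OF that] by simp
  with Uk obtain m2 where m2: "\<forall>j\<in>{1..n}. bij_betw (m2 j) {..<u} (U j)"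
    "\<forall>c<u. inj_on (\<lambda>j. m2 j c) {1..n}"
    using koenig_family[of "{1..n}" "{1..k}" U u] by auto
  \<comment> \<open>Colour \<open>c\<close> of the second colouring is row
    \<open>Suc r + c\<close>.\<close>
  define W where "W i j = m2 j (i - Suc r)" for i j
  have row_idx: "i - Suc r \<in> {..<u}" if "i \<in> {Suc r..n}" for i using that nru by auto
  have W_in: "W i j \<in> U j" if "j \<in> {1..n}" "i \<in> {Suc r..n}" for i j
    using m2(1) that row_idx bij_betwE unfolding W_def by blast
  have W_col: "inj_on (\<lambda>i. W i j) {Suc r..n}" if j: "j \<in> {1..n}" for j
  proof (rule inj_onI)
    fix i i' assume i: "i \<in> {Suc r..n}" "i' \<in> {Suc r..n}" "W i j = W i' j"
    have "i - Suc r = i' - Suc r"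
      using bij_betw_imp_inj_on[OF m2(1)[rule_format, OF j]] i row_idx
      unfolding W_def by (blast dest: inj_onD)
    then show "i = i'" using i by auto
  qed
  have W_row: "inj_on (W i) {1..n}" if "i \<in> {Suc r..n}" for i
    using m2(2) row_idx[OF that] unfolding W_def by blast

  define M where "M i j = (if i \<le> r then if j \<le> s then L i j else Q i j else W i j)" for i j
  have range1: "{1..n} = {1..r} \<union> {Suc r..n}" and range2: "{1..n} = {1..s} \<union> {Suc s..n}"
    using rn sn by auto
  have Mk: "M i j \<in> {1..k}" if ij: "i \<in> {1..n}" "j \<in> {1..n}" for i j
  proof -
    consider "i \<in> {1..r}" "j \<in> {1..s}" | "i \<in> {1..r}" "j \<in> {Suc s..n}" | "i \<in> {Suc r..n}"
      using ij by force
    then show ?thesis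
    proof cases
      case 1 then show ?thesis using L(1) by (simp add: M_def)
    next
      case 2 then show ?thesis using Q_in[of i j] Sk[of i] ij(1) by (auto simp: M_def)
    next
      case 3 then show ?thesis using W_in[of j i] Uk[of j] ij(2) by (auto simp: M_def)
    qed
  qed
  have M_row: "inj_on (M i) {1..n}" if i: "i \<in> {1..n}" for i
  proof (cases "i \<le> r")
    case True
    then have ir: "i \<in> {1..r}" using i by simp
    have "inj_on (M i) {1..s} = inj_on (L i) {1..s}"
      using True by (intro inj_on_cong) (simp add: M_def)
    then have "inj_on (M i) {1..s}" using L(2)[OF ir] by simp
    moreover have "inj_on (M i) {Suc s..n} = inj_on (Q i) {Suc s..n}"
      using True by (intro inj_on_cong) (simp add: M_def)
    then have "inj_on (M i) {Suc s..n}" using Q_row[OF i] by simp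
    moreover have "M i j \<noteq> M i j'" if "j \<in> {1..s}" "j' \<in> {Suc s..n}" for j j'
    proof -
      have "Q i j' \<in> F i" using Q_in[OF i that(2)] True by (simp add: S_def)
      then have "Q i j' \<notin> L i ` {1..s}" using F[OF ir] by blast
      then have "Q i j' \<noteq> L i j" using that(1) by blast
      then show ?thesis using that True by (simp add: M_def)
    qed
    ultimately show ?thesis
      unfolding range2 by (rule inj_on_UnI)
  next
    case False
    then have "inj_on (M i) {1..n} = inj_on (W i) {1..n}"
      by (intro inj_on_cong) (simp add: M_def)
    then show ?thesis using W_row[of i] i False by simp
  qed
  have M_col: "inj_on (\<lambda>i. M i j) {1..n}" if j: "j \<in> {1..n}" for j
  proof -
    have top: "inj_on (\<lambda>i. M i j) {1..r}"
    proof (cases "j \<le> s")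
      case True
      then have "inj_on (\<lambda>i. M i j) {1..r} = inj_on (\<lambda>i. L i j) {1..r}"
        by (intro inj_on_cong) (simp add: M_def)
      then show ?thesis using L(3)[of j] j True by simp
    next
      case False
      have "inj_on (\<lambda>i. Q i j) {1..r}"
        using False j rn by (intro inj_on_subset[OF Q_col[of j]]) auto
      moreover have "inj_on (\<lambda>i. M i j) {1..r} = inj_on (\<lambda>i. Q i j) {1..r}"
        using False by (intro inj_on_cong) (simp add: M_def)
      ultimately show ?thesis by simp
    qed
    have "inj_on (\<lambda>i. M i j) {Suc r..n} = inj_on (\<lambda>i. W i j) {Suc r..n}"
      by (intro inj_on_cong) (simp add: M_def)
    then have bottom: "inj_on (\<lambda>i. M i j) {Suc r..n}" using W_col[OF j] by simp
    have "M i j \<noteq> M i' j" if i: "i \<in> {1..r}" "i' \<in> {Suc r..n}" for i i'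
    proof (cases "j \<le> s")
      case True
      have "W i' j \<in> H j" using W_in[OF j i(2)] True by (simp add: U_def)
      then have "W i' j \<notin> (\<lambda>i. L i j) ` {1..r}" using H[of j] True j by auto
      then have "W i' j \<noteq> L i j" using i(1) by blast
      then show ?thesis using i True by (simp add: M_def)
    next
      case False
      \<comment> \<open>The second colouring only permutes the bottom symbols of column
        \<open>j\<close>. So \<open>W i' j\<close> is the provisional entry of some row below
        \<open>r\<close>, which differs from \<open>Q i j\<close> because the columns of
        \<open>Q\<close> are injective.\<close>
      then have "W i' j \<in> (\<lambda>i. Q i j) ` {Suc r..n}" using W_in[OF j i(2)] by (simp add: U_def)
      then obtain i'' where i'': "i'' \<in> {Suc r..n}" "W i' j = Q i'' j" by blast
      have "j \<in> {Suc s..n}" "i \<in> {1..n}" "i'' \<in> {1..n}" "i \<noteq> i''"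
        using False j i(1) i''(1) rn by simp_all
      then have "Q i j \<noteq> Q i'' j" using inj_onD[OF Q_col] by blast
      then show ?thesis using i i'' False by (simp add: M_def)
    qed
    with top bottom show ?thesis
      unfolding range1 by (rule inj_on_UnI)
  qed
  \<comment> \<open>Upper bounds suffice: both sides add up to \<open>n ^ 2\<close> over all
    symbols, which forces equality afterwards.\<close>
  have le: "occ n n M l \<le> rho l" if l: "l \<in> {1..k}" for l
  proof -
    have "occ n n M l = occ_in {1..r} {1..n} M l + occ_in {Suc r..n} {1..n} M l"
      unfolding occ_eq_occ_in by (subst range1, subst occ_in_Un_rows) auto
    also have "occ_in {1..r} {1..n} M l = occ_in {1..r} {1..s} M l + occ_in {1..r} {Suc s..n} M l"
      by (subst range2, subst occ_in_Un_cols) auto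
    also have "occ_in {1..r} {1..s} M l = occ r s L l"
      unfolding occ_eq_occ_in by (rule occ_in_cong) (simp add: M_def)
    finally have 1: "occ n n M l =
      occ r s L l + occ_in {1..r} {Suc s..n} M l + occ_in {Suc r..n} {1..n} M l" .
    have "occ_in {1..r} {Suc s..n} M l = card {i\<in>{1..r}. l \<in> M i ` {Suc s..n}}"
      using rn by (intro occ_in_eq_card_rows inj_on_subset[OF M_row]) auto
    also have "\<dots> \<le> card {i\<in>{1..r}. l \<in> F i}"
    proof (rule card_mono)
      have "M i j \<in> F i" if "i \<in> {1..r}" "j \<in> {Suc s..n}" for i j
        using Q_in[of i j] that rn by (simp add: S_def M_def)
      then show "{i\<in>{1..r}. l \<in> M i ` {Suc s..n}} \<subseteq> {i\<in>{1..r}. l \<in> F i}" by blast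
    qed simp
    finally have 2: "occ_in {1..r} {Suc s..n} M l \<le> A l" using FA[OF l] by simp
    have "occ_in {Suc r..n} {1..n} M l = occ_in {1..n} {Suc r..n} (transp_arr M) l"
      by (rule occ_in_transp[symmetric])
    also have "\<dots> = card {j\<in>{1..n}. l \<in> transp_arr M j ` {Suc r..n}}"
      unfolding transp_arr_def by (intro occ_in_eq_card_rows inj_on_subset[OF M_col]) auto
    also have "\<dots> \<le> card {j\<in>{1..n}. l \<in> U j}"
    proof (rule card_mono)
      have "M i j \<in> U j" if "j \<in> {1..n}" "i \<in> {Suc r..n}" for i j
        using W_in[of j i] that by (simp add: M_def)
      then show "{j\<in>{1..n}. l \<in> transp_arr M j ` {Suc r..n}} \<subseteq> {j\<in>{1..n}. l \<in> U j}"
        unfolding transp_arr_def by blast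
    qed simp
    finally have 3: "occ_in {Suc r..n} {1..n} M l \<le> B l + D l" using Udeg[OF l] by simp
    show ?thesis using 1 2 3 rhoD[OF l] by linarith
  qed
  have "(\<Sum>l\<in>{1..k}. occ n n M l) = (\<Sum>l\<in>{1..k}. rho l)"
    unfolding rho_sum occ_eq_occ_in using Mk by (subst sum_occ_in) (auto simp: power2_eq_square)
  then have "occ n n M l = rho l" if "l \<in> {1..k}" for l
    using sum_mono_inv[of "occ n n M" "{1..k}" rho] le that by blast
  then have "rho_latin_square n k rho M"
    using Mk M_row M_col by (simp add: rho_latin_square_def occ_def)
  moreover have "\<forall>i\<in>{1..r}. \<forall>j\<in>{1..s}. M i j = L i j" by (simp add: M_def)
  ultimately show ?thesis unfolding completable_def by blast
qed

section \<open>Fitting sequences\<close>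

text \<open>The number of copies of \<open>l\<close> in the top right block. The maximum is a lower bound for it, since at
  most \<open>n - r\<close> of the missing copies fit into the last \<open>n - r\<close> rows; \<open>a l\<close> is the excess.\<close>
definition quota ::
  "nat \<Rightarrow> (nat \<Rightarrow> nat) \<Rightarrow> nat \<Rightarrow> nat \<Rightarrow> (nat \<Rightarrow> nat \<Rightarrow> nat) \<Rightarrow> (nat \<Rightarrow> int) \<Rightarrow> nat \<Rightarrow> int" where
  "quota n rho r s L a l =
     a l + max 0 (int (rho l) - int (occ r s L l) - (int n - int r))"

lemma quota_in_Pset:
  assumes "l \<in> Pset n k rho r s L r"
  shows "quota n rho r s L a l = a l + int (rho l) - int (occ r s L l) - int n + int r"
  using assms by (simp add: quota_def Pset_def)

lemma quota_notin_Pset: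
  assumes "l \<in> {1..k} - Pset n k rho r s L r"
  shows "quota n rho r s L a l = a l"
  using assms by (auto simp: quota_def Pset_def)

lemma Pset_subset: "Pset n k rho r s L t \<subseteq> {1..k}"
  by (auto simp: Pset_def)

lemma sum_split_Pset:
  fixes f :: "nat \<Rightarrow> int"
  shows "(\<Sum>l\<in>{1..k}. f l) =
    (\<Sum>l\<in>Pset n k rho r s L t. f l) + (\<Sum>l\<in>{1..k} - Pset n k rho r s L t. f l)"
  using sum.subset_diff[OF Pset_subset[of n k rho r s L t], of f] by simp

text \<open>The maximum in \<open>quota\<close> is nonzero exactly on \<open>P\<close>, so quota
  sums become the expressions in \<open>R2\<close>, \<open>R4\<close>, \<open>R5\<close> and
  \<open>R6\<close>.\<close>

lemma sum_quota:
  fixes n r s k :: nat and rho :: "nat \<Rightarrow> nat" and L :: "nat \<Rightarrow> nat \<Rightarrow> nat"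
  defines "P \<equiv> Pset n k rho r s L r"
  assumes K: "K \<subseteq> {1..k}"
  shows "(\<Sum>l\<in>K. quota n rho r s L a l) = (\<Sum>l\<in>K. a l)
    + (\<Sum>l\<in>K \<inter> P. int (rho l) - int (occ r s L l)) - int (card (K \<inter> P)) * (int n - int r)"
proof -
  have finK: "finite K" using K finite_subset by blast
  have "(\<Sum>l\<in>K. quota n rho r s L a l) = (\<Sum>l\<in>K. a l) +
      (\<Sum>l\<in>K. if l \<in> P then int (rho l) - int (occ r s L l) - (int n - int r) else 0)"
    unfolding quota_def sum.distrib P_def using K
    by (intro arg_cong2[of _ _ _ _ "(+)"] sum.cong refl) (auto simp: Pset_def)
  also have "(\<Sum>l\<in>K. if l \<in> P then int (rho l) - int (occ r s L l) - (int n - int r) else 0)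
      = (\<Sum>l\<in>K \<inter> P. int (rho l) - int (occ r s L l) - (int n - int r))"
    using finK by (simp add: sum.inter_restrict)
  also have "\<dots> = (\<Sum>l\<in>K \<inter> P. int (rho l) - int (occ r s L l))
      - int (card (K \<inter> P)) * (int n - int r)"
    by (simp add: sum_subtractf)
  finally show ?thesis by simp
qed

text \<open>Rows of \<open>L\<close> are injective, so \<open>occ r s L l\<close> is the number of
  rows containing \<open>l\<close>; the other two terms count the rows without it, inside and
  outside \<open>I\<close>.\<close>

lemma mu_rows_sym_complement:
  assumes inj: "\<And>i. i \<in> {1..r} \<Longrightarrow> inj_on (L i) {1..s}" and I: "I \<subseteq> {1..r}"
  shows "mu_rows_sym s L I l + mu_rows_sym s L ({1..r} - I) l + occ r s L l = r"
proof -
  define Z where "Z = {i\<in>{1..r}. l \<notin> L i ` {1..s}}"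
  have "finite Z" and Z: "Z \<subseteq> {1..r}" by (auto simp: Z_def)
  have "card {1..r} = card Z + card ({1..r} - Z)"
    using card_Int_Diff[of "{1..r}" Z] Z by (simp add: Int_absorb1)
  moreover have "card Z = card (Z \<inter> I) + card (Z - I)"
    using \<open>finite Z\<close> by (rule card_Int_Diff)
  moreover have "Z \<inter> I = {i\<in>I. l \<notin> L i ` {1..s}}" using I unfolding Z_def by blast
  moreover have "Z - I = {i\<in>{1..r} - I. l \<notin> L i ` {1..s}}" unfolding Z_def by blast
  moreover have "{1..r} - Z = {i\<in>{1..r}. l \<in> L i ` {1..s}}" unfolding Z_def by blast
  ultimately show ?thesis
    using occ_in_eq_card_rows[of "{1..r}" L "{1..s}" l, OF inj]
    by (simp only: mu_rows_sym_def occ_eq_occ_in) simp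
qed

section \<open>The row conditions in terms of quotas\<close>

lemma R1_iff_quota:
  "R1 n k rho r s L a \<longleftrightarrow> (\<forall>I. I \<subseteq> {1..r} \<longrightarrow> int (card I) * (int n - int s)
     \<le> (\<Sum>l\<in>{1..k}. min (quota n rho r s L a l) (int (mu_rows_sym s L I l))))"
proof -
  let ?P = "Pset n k rho r s L r"
  have "(\<Sum>l\<in>?P. min (a l + int (rho l) - int (occ r s L l) - int n + int r) (int (mu_rows_sym s L I l)))
       + (\<Sum>l\<in>{1..k} - ?P. min (a l) (int (mu_rows_sym s L I l)))
      = (\<Sum>l\<in>{1..k}. min (quota n rho r s L a l) (int (mu_rows_sym s L I l)))" for I
    unfolding sum_split_Pset[of _ k n rho r s L r]
    by (intro arg_cong2[of _ _ _ _ "(+)"] sum.cong refl)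
      (simp_all only: quota_in_Pset quota_notin_Pset)
  then show ?thesis by (simp only: R1_def Let_def)
qed

lemma R3_iff_quota:
  assumes "\<And>i. i \<in> {1..r} \<Longrightarrow> inj_on (L i) {1..s}"
  shows "R3 n k rho r s L a \<longleftrightarrow> (\<forall>I. I \<subseteq> {1..r} \<longrightarrow>
     (\<Sum>l\<in>{1..k}. dminus (quota n rho r s L a l) (int (mu_rows_sym s L ({1..r} - I) l)))
       \<le> int (card I) * (int n - int s))"
proof -
  let ?P = "Pset n k rho r s L r"
  have eq: "(\<Sum>l\<in>?P. dminus (a l + int (rho l) + int (mu_rows_sym s L I l)) (int n))
       + (\<Sum>l\<in>{1..k} - ?P. dminus (a l) (int (mu_rows_sym s L ({1..r} - I) l)))
      = (\<Sum>l\<in>{1..k}. dminus (quota n rho r s L a l) (int (mu_rows_sym s L ({1..r} - I) l)))"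
    if I: "I \<subseteq> {1..r}" for I
    unfolding sum_split_Pset[of _ k n rho r s L r]
  proof (intro arg_cong2[of _ _ _ _ "(+)"] sum.cong refl)
    fix l assume l: "l \<in> ?P"
    \<comment> \<open>Eliminating the count for the complement by this identity cancels
      \<open>r\<close> and \<open>occ r s L l\<close> and leaves the summand of \<open>R3\<close> on
      \<open>?P\<close>.\<close>
    have "int (mu_rows_sym s L I l) + int (mu_rows_sym s L ({1..r} - I) l)
        + int (occ r s L l) = int r"
      using mu_rows_sym_complement[of r L s I l, OF assms I] by linarith
    then show "dminus (a l + int (rho l) + int (mu_rows_sym s L I l)) (int n)
        = dminus (quota n rho r s L a l) (int (mu_rows_sym s L ({1..r} - I) l))"
      unfolding quota_in_Pset[OF l] dminus_def by linarith
  qed (simp only: quota_notin_Pset)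
  show ?thesis unfolding R3_def Let_def
    by (intro all_cong1 imp_cong refl) (simp only: eq)
qed

text \<open>Each condition is rewritten with quotas as prescribed degrees;
  \<open>degree_conditions_equiv\<close> then applies to the relation "symbol \<open>l\<close> is
  missing from row \<open>i\<close>".\<close>

lemma R_conditions_equiv:
  assumes inj: "\<And>i. i \<in> {1..r} \<Longrightarrow> inj_on (L i) {1..s}"
    and total: "(\<Sum>l\<in>{1..k}. quota n rho r s L a l) = int r * (int n - int s)"
  shows "R1 n k rho r s L a \<longleftrightarrow> R2 n k rho r s L a" "R1 n k rho r s L a \<longleftrightarrow> R3 n k rho r s L a"
    "R1 n k rho r s L a \<longleftrightarrow> R4 n k rho r s L a" "R1 n k rho r s L a \<longleftrightarrow> R5 n k rho r s L a"
    "R1 n k rho r s L a \<longleftrightarrow> R6 n k rho r s L a"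
proof -
  let ?q = "quota n rho r s L a"
  have R2: "R2 n k rho r s L a \<longleftrightarrow> (\<forall>K. K \<subseteq> {1..k} \<longrightarrow>
      (\<Sum>l\<in>K. ?q l) \<le> (\<Sum>i\<in>{1..r}. min (int n - int s) (int (mu_row_syms s L K i))))"
    unfolding R2_def Let_def by (intro all_cong1 imp_cong refl) (auto simp: sum_quota)
  have R4: "R4 n k rho r s L a \<longleftrightarrow> (\<forall>K. K \<subseteq> {1..k} \<longrightarrow>
      (\<Sum>i\<in>{1..r}. dminus (int n - int s) (int (mu_row_syms s L ({1..k} - K) i))) \<le> (\<Sum>l\<in>K. ?q l))"
    unfolding R4_def Let_def by (intro all_cong1 imp_cong refl) (auto simp: sum_quota)
  have R5: "R5 n k rho r s L a \<longleftrightarrow> (\<forall>I. I \<subseteq> {1..r} \<longrightarrow> (\<forall>K. K \<subseteq> {1..k} \<longrightarrow>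
      int (card I) * (int n - int s) \<le> (\<Sum>l\<in>K. ?q l) + int (\<Sum>l\<in>{1..k} - K. mu_rows_sym s L I l)))"
    unfolding R5_def Let_def by (intro all_cong1 imp_cong refl) (auto simp: sum_quota)
  have R6: "R6 n k rho r s L a \<longleftrightarrow> (\<forall>I. I \<subseteq> {1..r} \<longrightarrow> (\<forall>K. K \<subseteq> {1..k} \<longrightarrow>
      (\<Sum>l\<in>K. ?q l) \<le> int (card I) * (int n - int s) + int (\<Sum>i\<in>{1..r} - I. mu_row_syms s L K i)))"
    unfolding R6_def Let_def by (intro all_cong1 imp_cong refl) (auto simp: sum_quota)
  have total': "(\<Sum>l\<in>{1..k}. ?q l) = int (card {1..r}) * (int n - int s)" using total by simp
  note T = degree_conditions_equiv[OF finite_atLeastAtMost finite_atLeastAtMost total',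
      where R = "\<lambda>i l. l \<notin> (\<lambda>j. L i j) ` {1..s}", folded mu_rows_sym_def mu_row_syms_def,
      folded R1_iff_quota]
  show "R1 n k rho r s L a \<longleftrightarrow> R2 n k rho r s L a" unfolding R2 by (rule T(3)[symmetric])
  show "R1 n k rho r s L a \<longleftrightarrow> R3 n k rho r s L a"
    by (rule trans[OF T(4)[symmetric] R3_iff_quota[symmetric]]) (rule inj)
  show "R1 n k rho r s L a \<longleftrightarrow> R4 n k rho r s L a" unfolding R4 by (rule T(5)[symmetric])
  show "R1 n k rho r s L a \<longleftrightarrow> R5 n k rho r s L a" unfolding R5 by (rule T(1)[symmetric])
  show "R1 n k rho r s L a \<longleftrightarrow> R6 n k rho r s L a" unfolding R6 by (rule T(2)[symmetric])
qed

section \<open>Interchanging rows and columns, and fitting sequences as quotas\<close>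

lemma occ_transp: "occ s r (transp_arr L) = occ r s L"
  by (rule ext) (simp add: occ_eq_occ_in occ_in_transp)

lemma Pset_transp: "Pset n k rho s r (transp_arr L) = Pset n k rho r s L"
  by (rule ext) (simp add: Pset_def occ_transp)

lemma fitting_transp: "fitting n k rho r s L a b \<Longrightarrow> fitting n k rho s r (transp_arr L) b a"
  by (auto simp: fitting_def Let_def occ_transp Pset_transp min.commute max.commute add.commute)

text \<open>The two sum conditions say that quotas fill the top right and bottom left blocks. The
  three cases of the pointwise bound record whether both, one or none of the maxima in the quotas
  are positive; in each case the bound says that a nonnegative number of copies of \<open>l\<close>
  remains for the last block.\<close>

lemma fitting_iff_quota:
  assumes "\<And>l. l \<in> {1..k} \<Longrightarrow> a l \<ge> 0 \<and> b l \<ge> 0"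
  shows "fitting n k rho r s L a b \<longleftrightarrow>
     (\<Sum>l\<in>{1..k}. quota n rho r s L a l) = int r * (int n - int s) \<and>
     (\<Sum>l\<in>{1..k}. quota n rho s r (transp_arr L) b l) = int s * (int n - int r) \<and>
     (\<forall>l\<in>{1..k}. quota n rho r s L a l + quota n rho s r (transp_arr L) b l
        \<le> int (rho l) - int (occ r s L l))"
proof -
  let ?P = "Pset n k rho r s L"
  let ?d = "\<lambda>l. int (rho l) - int (occ r s L l)"
  have P: "{1..k} \<inter> ?P t = ?P t" for t
    using Pset_subset[of n k rho r s L t] by (rule Int_absorb1)
  have "(\<Sum>l\<in>{1..k}. a l) = int r * (int n - int s) + int (card (?P r)) * (int n - int r)
        - (\<Sum>l\<in>?P r. ?d l)
      \<longleftrightarrow> (\<Sum>l\<in>{1..k}. quota n rho r s L a l) = int r * (int n - int s)"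
    using sum_quota[of "{1..k}" k n rho r s L a, OF subset_refl] unfolding P by linarith
  moreover have "(\<Sum>l\<in>{1..k}. b l) = int s * (int n - int r) + int (card (?P s)) * (int n - int s)
        - (\<Sum>l\<in>?P s. ?d l)
      \<longleftrightarrow> (\<Sum>l\<in>{1..k}. quota n rho s r (transp_arr L) b l) = int s * (int n - int r)"
    using sum_quota[of "{1..k}" k n rho s r "transp_arr L" b, OF subset_refl]
    unfolding Pset_transp occ_transp P by linarith
  moreover have "(\<forall>l\<in>{1..k}. a l + b l \<le> (if l \<in> ?P (min r s)
           then 2 * int n - int r - int s + int (occ r s L l) - int (rho l)
         else if l \<in> ?P (max r s) then int n - int (max r s) else ?d l))
     \<longleftrightarrow> (\<forall>l\<in>{1..k}. quota n rho r s L a l + quota n rho s r (transp_arr L) b l \<le> ?d l)"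
    by (intro ball_cong refl; cases "r \<le> s")
      (auto simp: quota_def Pset_def occ_transp max_def min_def)
  moreover have "\<forall>l\<in>{1..k}. a l \<ge> 0 \<and> b l \<ge> 0" using assms by blast
  ultimately show ?thesis unfolding fitting_def Let_def by argo
qed

section \<open>Sufficiency and necessity of the conditions\<close>

text \<open>Condition \<open>R5\<close>, read over the naturals, is the hypothesis of
  \<open>family_with_degrees\<close> for the symbols missing from the rows. Passing to
  \<open>nat\<close> loses nothing because the quotas are nonnegative.\<close>

lemma family_of_R1:
  assumes sn: "s \<le> n" and a: "\<And>l. l \<in> {1..k} \<Longrightarrow> a l \<ge> 0"
    and inj: "\<And>i. i \<in> {1..r} \<Longrightarrow> inj_on (L i) {1..s}"
    and total: "(\<Sum>l\<in>{1..k}. quota n rho r s L a l) = int r * (int n - int s)"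
    and R1: "R1 n k rho r s L a"
  shows "\<exists>F. (\<forall>i\<in>{1..r}. F i \<subseteq> {1..k} - L i ` {1..s} \<and> card (F i) = n - s) \<and>
    (\<forall>l\<in>{1..k}. card {i\<in>{1..r}. l \<in> F i} = nat (quota n rho r s L a l))"
proof (rule family_with_degrees)
  have nonneg: "quota n rho r s L a l \<ge> 0" if "l \<in> {1..k}" for l
    using a[OF that] by (simp add: quota_def)
  have natsum: "int (\<Sum>l\<in>K. nat (quota n rho r s L a l)) = (\<Sum>l\<in>K. quota n rho r s L a l)"
    if "K \<subseteq> {1..k}" for K
    using nonneg that by (auto intro!: sum.cong)
  have "int (card {1..r} * (n - s)) = int r * (int n - int s)" using sn by (simp add: of_nat_diff)
  then have "int (\<Sum>l\<in>{1..k}. nat (quota n rho r s L a l)) = int (card {1..r} * (n - s))"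
    using natsum[OF subset_refl] total by (simp only:)
  then show "(\<Sum>l\<in>{1..k}. nat (quota n rho r s L a l)) = card {1..r} * (n - s)"
    by (simp only: of_nat_eq_iff)
  fix I K assume I: "I \<subseteq> {1..r}" and K: "K \<subseteq> {1..k}"
  have R5: "R5 n k rho r s L a" using R_conditions_equiv(4)[of r L s n rho a k] inj total R1 by blast
  have "int (card I) * (int n - int s) \<le> (\<Sum>l\<in>K. quota n rho r s L a l)
      + int (\<Sum>l\<in>{1..k} - K. mu_rows_sym s L I l)"
    using R5[unfolded R5_def Let_def, rule_format, OF I K] unfolding sum_quota[OF K] by linarith
  moreover have "{i\<in>I. l \<in> {1..k} - L i ` {1..s}} = {i\<in>I. l \<notin> (\<lambda>j. L i j) ` {1..s}}"
    if "l \<in> {1..k} - K" for l using that by auto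
  then have "(\<Sum>l\<in>{1..k} - K. card {i\<in>I. l \<in> {1..k} - L i ` {1..s}})
      = (\<Sum>l\<in>{1..k} - K. mu_rows_sym s L I l)"
    by (intro sum.cong refl) (simp only: mu_rows_sym_def)
  ultimately have "int (card I * (n - s)) \<le> int ((\<Sum>l\<in>K. nat (quota n rho r s L a l))
      + (\<Sum>l\<in>{1..k} - K. card {i\<in>I. l \<in> {1..k} - L i ` {1..s}}))"
    unfolding of_nat_add natsum[OF K] of_nat_mult of_nat_diff[OF sn] by simp
  then show "card I * (n - s) \<le> (\<Sum>l\<in>K. nat (quota n rho r s L a l))
      + (\<Sum>l\<in>{1..k} - K. card {i\<in>I. l \<in> {1..k} - L i ` {1..s}})"
    by (simp only: of_nat_le_iff)
qed auto

text \<open>The cells to the right of \<open>L\<close> in the rows \<open>I\<close> number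
  \<open>card I * (n - s)\<close>. A symbol fills at most its quota of them, and at most one in each
  row of \<open>I\<close> whose part in \<open>L\<close> lacks it.\<close>

lemma R1_of_square:
  fixes n :: nat
  assumes rn: "r \<le> n" and sn: "s \<le> n" and sq: "rho_latin_square n k rho M"
    and ext: "\<And>i j. i \<in> {1..r} \<Longrightarrow> j \<in> {1..s} \<Longrightarrow> M i j = L i j"
    and a: "\<And>l. l \<in> {1..k} \<Longrightarrow> quota n rho r s L a l = int (occ_in {1..r} {Suc s..n} M l)"
  shows "R1 n k rho r s L a"
  unfolding R1_iff_quota
proof (intro allI impI)
  fix I assume I: "I \<subseteq> {1..r}"
  have finI: "finite I" using I finite_subset by blast
  have M: "\<And>i j. i \<in> {1..n} \<Longrightarrow> j \<in> {1..n} \<Longrightarrow> M i j \<in> {1..k}"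
    "\<And>i. i \<in> {1..n} \<Longrightarrow> inj_on (M i) {1..n}"
    using sq by (simp_all add: rho_latin_square_def)
  have row: "inj_on (M i) {Suc s..n}" if "i \<in> {1..r}" for i
    using that rn by (intro inj_on_subset[OF M(2)]) auto
  have "(\<Sum>l\<in>{1..k}. occ_in I {Suc s..n} M l) = card I * card {Suc s..n}"
    using I rn finI by (intro sum_occ_in M(1)) auto
  then have "int (card I) * (int n - int s) = (\<Sum>l\<in>{1..k}. int (occ_in I {Suc s..n} M l))"
    using sn by (simp add: of_nat_diff flip: of_nat_sum)
  also have "\<dots> \<le> (\<Sum>l\<in>{1..k}. min (quota n rho r s L a l) (int (mu_rows_sym s L I l)))"
  proof (rule sum_mono)
    fix l assume l: "l \<in> {1..k}"
    have "occ_in {1..r} {Suc s..n} M l = occ_in (I \<union> ({1..r} - I)) {Suc s..n} M l"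
      using I by (simp add: Un_absorb1)
    also have "\<dots> = occ_in I {Suc s..n} M l + occ_in ({1..r} - I) {Suc s..n} M l"
      using finI by (intro occ_in_Un_rows) auto
    finally have "occ_in I {Suc s..n} M l \<le> occ_in {1..r} {Suc s..n} M l" by simp
    moreover have "occ_in I {Suc s..n} M l \<le> mu_rows_sym s L I l"
    proof -
      have "occ_in I {Suc s..n} M l = card {i\<in>I. l \<in> M i ` {Suc s..n}}"
        using row I by (intro occ_in_eq_card_rows) blast
      also have "\<dots> \<le> card {i\<in>I. l \<notin> (\<lambda>j. L i j) ` {1..s}}"
      proof (rule card_mono)
        have "M i j \<noteq> L i j'" if "i \<in> I" "j \<in> {Suc s..n}" "j' \<in> {1..s}" for i j j'
        proof -
          have "i \<in> {1..n}" "j \<in> {1..n}" "j' \<in> {1..n}" "j \<noteq> j'" using that I rn sn by auto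
          then have "M i j \<noteq> M i j'" using inj_onD[OF M(2)] by blast
          moreover have "M i j' = L i j'" using ext that I by blast
          ultimately show ?thesis by simp
        qed
        then show "{i\<in>I. l \<in> M i ` {Suc s..n}} \<subseteq> {i\<in>I. l \<notin> (\<lambda>j. L i j) ` {1..s}}" by fastforce
      qed (use finI in simp)
      finally show ?thesis by (simp only: mu_rows_sym_def)
    qed
    ultimately show "int (occ_in I {Suc s..n} M l)
        \<le> min (quota n rho r s L a l) (int (mu_rows_sym s L I l))"
      using a[OF l] by simp
  qed
  finally show "int (card I) * (int n - int s)
    \<le> (\<Sum>l\<in>{1..k}. min (quota n rho r s L a l) (int (mu_rows_sym s L I l)))" .
qed

lemma rho_latin_square_transp:
  "rho_latin_square n k rho M \<Longrightarrow> rho_latin_square n k rho (transp_arr M)"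
  unfolding rho_latin_square_def occ_in_def[symmetric] occ_in_transp by (simp add: transp_arr_def)

lemma completable_imp_fitting:
  fixes n :: nat
  assumes rn: "r \<le> n" and sn: "s \<le> n" and "completable n k rho r s L"
  shows "\<exists>a b. fitting n k rho r s L a b \<and> R1 n k rho r s L a \<and> C1 n k rho r s L b"
proof -
  obtain M where sq: "rho_latin_square n k rho M"
    and ext: "\<And>i j. i \<in> {1..r} \<Longrightarrow> j \<in> {1..s} \<Longrightarrow> M i j = L i j"
    using assms(3) unfolding completable_def by blast
  have M: "\<And>i j. i \<in> {1..n} \<Longrightarrow> j \<in> {1..n} \<Longrightarrow> M i j \<in> {1..k}"
    "\<And>i. i \<in> {1..n} \<Longrightarrow> inj_on (M i) {1..n}"
    "\<And>j. j \<in> {1..n} \<Longrightarrow> inj_on (transp_arr M j) {1..n}"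
    "\<And>l. l \<in> {1..k} \<Longrightarrow> occ_in {1..n} {1..n} M l = rho l"
    using sq by (simp_all add: rho_latin_square_def occ_in_def transp_arr_def)
  define A where "A l = occ_in {1..r} {Suc s..n} M l" for l
  define B where "B l = occ_in {1..s} {Suc r..n} (transp_arr M) l" for l
  define D where "D l = occ_in {Suc r..n} {Suc s..n} M l" for l
  have Bl: "B l = occ_in {Suc r..n} {1..s} M l" for l unfolding B_def by (rule occ_in_transp)
  have range1: "{1..n} = {1..r} \<union> {Suc r..n}" and range2: "{1..n} = {1..s} \<union> {Suc s..n}"
    using rn sn by auto
  have bottom: "occ_in {Suc r..n} {1..n} M l = B l + D l" for l
    unfolding Bl D_def by (subst range2, subst occ_in_Un_cols) auto
  have right: "occ_in {1..n} {Suc s..n} M l = A l + D l" for l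
    unfolding A_def D_def by (subst range1, subst occ_in_Un_rows) auto
  have "occ_in {1..r} {1..s} M l = occ r s L l" for l
    unfolding occ_eq_occ_in by (rule occ_in_cong) (rule ext)
  then have top: "occ_in {1..r} {1..n} M l = occ r s L l + A l" for l
    unfolding A_def by (subst range2, subst occ_in_Un_cols) auto
  have "occ_in ({1..r} \<union> {Suc r..n}) {1..n} M l
      = occ_in {1..r} {1..n} M l + occ_in {Suc r..n} {1..n} M l" for l
    by (rule occ_in_Un_rows) auto
  then have "occ_in {1..n} {1..n} M l = occ r s L l + A l + B l + D l" for l
    unfolding range1[symmetric] top bottom by simp
  then have rho: "rho l = occ r s L l + A l + B l + D l" if "l \<in> {1..k}" for l
    using M(4)[OF that] by simp
  \<comment> \<open>Each of the last \<open>n - r\<close> rows holds \<open>l\<close> at most once;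
    transposing gives the same for the last \<open>n - s\<close> columns.\<close>
  have BD: "B l + D l \<le> n - r" for l
    unfolding bottom[symmetric]
    using occ_in_le_card_rows[of "{Suc r..n}" M "{1..n}" l] M(2) by simp
  have "inj_on (transp_arr M j) {1..n}" if "j \<in> {Suc s..n}" for j using M(3) that by simp
  then have AD: "A l + D l \<le> n - s" for l
    unfolding right[symmetric] occ_in_transp[of "{Suc s..n}" "{1..n}" M, symmetric]
    using occ_in_le_card_rows[of "{Suc s..n}" "transp_arr M" "{1..n}" l] by simp
  \<comment> \<open>Subtracting the forced part makes the quotas equal to the block counts
    \<open>A l\<close> and \<open>B l\<close>. Nonnegativity of \<open>a\<close> is
    \<open>BD\<close> and that of \<open>b\<close> is \<open>AD\<close>, by way of
    \<open>rho\<close>.\<close>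
  define a where "a l = int (A l) - max 0 (int (rho l) - int (occ r s L l) - (int n - int r))" for l
  define b where "b l = int (B l) - max 0 (int (rho l) - int (occ r s L l) - (int n - int s))" for l
  have qa: "quota n rho r s L a l = int (A l)" for l by (simp add: quota_def a_def)
  have qb: "quota n rho s r (transp_arr L) b l = int (B l)" for l
    by (simp add: quota_def b_def occ_transp)
  have "a l \<ge> 0 \<and> b l \<ge> 0" if "l \<in> {1..k}" for l
    using rho[OF that] AD[of l] BD[of l] rn sn by (auto simp: a_def b_def)
  moreover have "(\<Sum>l\<in>{1..k}. A l) = card {1..r} * card {Suc s..n}"
    unfolding A_def using rn by (intro sum_occ_in M(1)) auto
  then have "(\<Sum>l\<in>{1..k}. int (A l)) = int r * (int n - int s)"
    using sn by (simp add: of_nat_diff flip: of_nat_sum)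
  moreover have "(\<Sum>l\<in>{1..k}. B l) = card {Suc r..n} * card {1..s}"
    unfolding Bl using sn by (intro sum_occ_in M(1)) auto
  then have "(\<Sum>l\<in>{1..k}. int (B l)) = int s * (int n - int r)"
    using rn by (simp add: of_nat_diff mult.commute flip: of_nat_sum)
  ultimately have "fitting n k rho r s L a b"
    using fitting_iff_quota[of k a b n rho r s L] rho by (simp add: qa qb)
  moreover have "R1 n k rho r s L a"
    using R1_of_square[OF rn sn sq ext] qa A_def by simp
  moreover have "R1 n k rho s r (transp_arr L) b"
    using R1_of_square[OF sn rn rho_latin_square_transp[OF sq], of "transp_arr L" b] ext qb B_def
    by (simp add: transp_arr_def)
  ultimately show ?thesis unfolding C1_def by blast
qed

lemma fitting_imp_completable:
  assumes rn: "r \<le> n" and sn: "s \<le> n" and rect: "rho_latin_rect k rho r s L"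
    and rho_sum: "(\<Sum>l\<in>{1..k}. rho l) = n ^ 2"
    and fit: "fitting n k rho r s L a b" and R1: "R1 n k rho r s L a" and C1: "C1 n k rho r s L b"
  shows "completable n k rho r s L"
proof -
  have nonneg: "a l \<ge> 0 \<and> b l \<ge> 0" if "l \<in> {1..k}" for l
    using fit that by (simp add: fitting_def Let_def)
  define qa where "qa = quota n rho r s L a"
  define qb where "qb = quota n rho s r (transp_arr L) b"
  have tot: "(\<Sum>l\<in>{1..k}. qa l) = int r * (int n - int s)"
    "(\<Sum>l\<in>{1..k}. qb l) = int s * (int n - int r)"
    and q: "\<And>l. l \<in> {1..k} \<Longrightarrow> qa l + qb l \<le> int (rho l) - int (occ r s L l)"
    using fit fitting_iff_quota[of k a b n rho r s L] nonneg by (auto simp: qa_def qb_def)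
  have inj: "\<And>i. i \<in> {1..r} \<Longrightarrow> inj_on (L i) {1..s}"
    "\<And>j. j \<in> {1..s} \<Longrightarrow> inj_on (transp_arr L j) {1..r}"
    using rect by (simp_all add: rho_latin_rect_def transp_arr_def)
  have "\<exists>F. (\<forall>i\<in>{1..r}. F i \<subseteq> {1..k} - L i ` {1..s} \<and> card (F i) = n - s) \<and>
      (\<forall>l\<in>{1..k}. card {i\<in>{1..r}. l \<in> F i} = nat (qa l))"
    unfolding qa_def
    by (rule family_of_R1[OF sn _ _ tot(1)[unfolded qa_def] R1]) (simp only: nonneg, rule inj(1))
  then obtain F where F: "\<forall>i\<in>{1..r}. F i \<subseteq> {1..k} - L i ` {1..s} \<and> card (F i) = n - s"
    "\<forall>l\<in>{1..k}. card {i\<in>{1..r}. l \<in> F i} = nat (qa l)"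
    by (elim exE conjE)
  have "\<exists>H. (\<forall>j\<in>{1..s}. H j \<subseteq> {1..k} - transp_arr L j ` {1..r} \<and> card (H j) = n - r) \<and>
      (\<forall>l\<in>{1..k}. card {j\<in>{1..s}. l \<in> H j} = nat (qb l))"
    unfolding qb_def
    by (rule family_of_R1[OF rn _ _ tot(2)[unfolded qb_def] C1[unfolded C1_def]])
      (simp only: nonneg, rule inj(2))
  then obtain H where H: "\<forall>j\<in>{1..s}. H j \<subseteq> {1..k} - transp_arr L j ` {1..r} \<and> card (H j) = n - r"
    "\<forall>l\<in>{1..k}. card {j\<in>{1..s}. l \<in> H j} = nat (qb l)"
    by (elim exE conjE)
  \<comment> \<open>The last two bounds come from the maximum in \<open>quota\<close>; they become
    the hypotheses \<open>Amin\<close> and \<open>Bmin\<close> of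
    \<open>completable_if_families\<close>.\<close>
  have qge: "qa l \<ge> 0" "qb l \<ge> 0" "qa l \<ge> int (rho l) - int (occ r s L l) - (int n - int r)"
    "qb l \<ge> int (rho l) - int (occ r s L l) - (int n - int s)" if "l \<in> {1..k}" for l
    using nonneg[OF that] by (auto simp: qa_def qb_def quota_def occ_transp)
  show ?thesis
  proof (rule completable_if_families[OF rn sn rect rho_sum F(1)[rule_format] F(2)[rule_format]
        H(1)[unfolded transp_arr_def, rule_format] H(2)[rule_format]])
    fix l assume l: "l \<in> {1..k}"
    show "occ r s L l + nat (qa l) + nat (qb l) \<le> rho l"
      "rho l \<le> occ r s L l + nat (qa l) + (n - r)"
      "rho l \<le> occ r s L l + nat (qb l) + (n - s)"
      using qge[OF l] q[OF l] rn sn by linarith+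
  qed
qed

lemma fitting_imp_R_equiv:
  assumes rect: "rho_latin_rect k rho r s L" and fit: "fitting n k rho r s L a b"
  shows "(R1 n k rho r s L a \<longleftrightarrow> R2 n k rho r s L a) \<and> (R1 n k rho r s L a \<longleftrightarrow> R3 n k rho r s L a) \<and>
    (R1 n k rho r s L a \<longleftrightarrow> R4 n k rho r s L a) \<and> (R1 n k rho r s L a \<longleftrightarrow> R5 n k rho r s L a) \<and>
    (R1 n k rho r s L a \<longleftrightarrow> R6 n k rho r s L a)"
proof -
  have "\<And>l. l \<in> {1..k} \<Longrightarrow> a l \<ge> 0 \<and> b l \<ge> 0"
    using fit by (simp add: fitting_def Let_def)
  then have "(\<Sum>l\<in>{1..k}. quota n rho r s L a l) = int r * (int n - int s)"
    using fit fitting_iff_quota[of k a b n rho r s L] by blast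
  moreover have "\<And>i. i \<in> {1..r} \<Longrightarrow> inj_on (L i) {1..s}"
    using rect by (simp add: rho_latin_rect_def)
  ultimately show ?thesis by (intro conjI R_conditions_equiv) simp_all
qed

lemma rho_latin_rect_transp:
  "rho_latin_rect k rho r s L \<Longrightarrow> rho_latin_rect k rho s r (transp_arr L)"
  unfolding rho_latin_rect_def occ_in_def[symmetric] occ_in_transp by (simp add: transp_arr_def)

theorem theorem1p2:
  fixes n k r s :: nat and rho :: "nat \<Rightarrow> nat" and L :: "nat \<Rightarrow> nat \<Rightarrow> nat"
  assumes "1 \<le> n" and "n \<le> k"
    and "\<forall>l\<in>{1..k}. 1 \<le> rho l \<and> rho l \<le> n"
    and "(\<Sum>l\<in>{1..k}. rho l) = n ^ 2"
    and "1 \<le> r" and "1 \<le> s" and "r \<le> n" and "s \<le> n" and "min r s < n"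
    and "rho_latin_rect k rho r s L"
  shows "(completable n k rho r s L \<longleftrightarrow>
            (\<exists>a b. fitting n k rho r s L a b \<and> R1 n k rho r s L a \<and> C1 n k rho r s L b))
       \<and> (\<forall>a b. fitting n k rho r s L a b \<longrightarrow>
            (R1 n k rho r s L a \<longleftrightarrow> R2 n k rho r s L a) \<and>
            (R1 n k rho r s L a \<longleftrightarrow> R3 n k rho r s L a) \<and>
            (R1 n k rho r s L a \<longleftrightarrow> R4 n k rho r s L a) \<and>
            (R1 n k rho r s L a \<longleftrightarrow> R5 n k rho r s L a) \<and>
            (R1 n k rho r s L a \<longleftrightarrow> R6 n k rho r s L a) \<and>
            (C1 n k rho r s L b \<longleftrightarrow> C2 n k rho r s L b) \<and>
            (C1 n k rho r s L b \<longleftrightarrow> C3 n k rho r s L b) \<and>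
            (C1 n k rho r s L b \<longleftrightarrow> C4 n k rho r s L b) \<and>
            (C1 n k rho r s L b \<longleftrightarrow> C5 n k rho r s L b) \<and>
            (C1 n k rho r s L b \<longleftrightarrow> C6 n k rho r s L b))"
proof (rule conjI)
  show "completable n k rho r s L \<longleftrightarrow>
      (\<exists>a b. fitting n k rho r s L a b \<and> R1 n k rho r s L a \<and> C1 n k rho r s L b)"
    using completable_imp_fitting fitting_imp_completable assms(4,7,8,10) by metis
next
  show "\<forall>a b. fitting n k rho r s L a b \<longrightarrow>
            (R1 n k rho r s L a \<longleftrightarrow> R2 n k rho r s L a) \<and>
            (R1 n k rho r s L a \<longleftrightarrow> R3 n k rho r s L a) \<and>
            (R1 n k rho r s L a \<longleftrightarrow> R4 n k rho r s L a) \<and>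
            (R1 n k rho r s L a \<longleftrightarrow> R5 n k rho r s L a) \<and>
            (R1 n k rho r s L a \<longleftrightarrow> R6 n k rho r s L a) \<and>
            (C1 n k rho r s L b \<longleftrightarrow> C2 n k rho r s L b) \<and>
            (C1 n k rho r s L b \<longleftrightarrow> C3 n k rho r s L b) \<and>
            (C1 n k rho r s L b \<longleftrightarrow> C4 n k rho r s L b) \<and>
            (C1 n k rho r s L b \<longleftrightarrow> C5 n k rho r s L b) \<and>
            (C1 n k rho r s L b \<longleftrightarrow> C6 n k rho r s L b)"
    \<comment> \<open>The column conditions are row conditions of the transposed array, for which
      \<open>b\<close>, \<open>a\<close> is a fitting sequence.\<close>
    unfolding C1_def C2_def C3_def C4_def C5_def C6_def
    using fitting_imp_R_equiv[OF assms(10)]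
      fitting_imp_R_equiv[OF rho_latin_rect_transp[OF assms(10)] fitting_transp]
    by blast
qed

end
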